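(* Let $(Y,d,\mu)$ be a Hölder doubling quasi metric space with doubling constant $C_D$, let $\Omega\subset Y$ be open, and let $\mathcal{S}_\Omega$, $\mathcal{L}(\Omega)$ and the families $\mathbb{K}_{\Omega,f}$, $f\in\mathcal{L}(\Omega)$, be as in the context. Suppose there exists $0<\delta<1$ such that $\mu(B_r(x))\le \delta\,\mu(B_{2r}(x))$ for every ball $B_{2r}(x)\subset\Omega$, and suppose that one of the following pairs of conditions holds. (A) (A1) There are constants $0<\nu,c,\gamma,\varepsilon<1$ and $\eta>1$ such that for every $f\in\mathcal{L}(\Omega)$ the family $\mathbb{K}_{\Omega,f}$ satisfies the double ball property $DB(\gamma,\varepsilon,\eta)$ and the critical density property $CD(\nu,c,\varepsilon,\eta)$; and (A2) $(Y,d,\mu)$ satisfies the ring condition with a function $\omega(s)=o(\log^{-2}(1/s))$ as $s\to0^+$. (B) (B1) There are constants $0<\nu<1/C_D^2$, $0<c,\varepsilon<1$ and $\eta>1$ such that for every $f\in\mathcal{L}(\Omega)$ the family $\mathbb{K}_{\Omega,f}$ satisfies the critical density property $CD(\nu,c,\varepsilon,\eta)$; and (B2) for every $x\in Y$ the function $r\mapsto\mu(B_r(x))$ is continuous. Then, for every $f\in\mathcal{L}(\Omega)$, the family $\mathbb{K}_{\Omega,f}$ satisfies the power decay property; that is, there exist constants $0<\gamma_P,\varepsilon_P<1$ and $M,\eta_P>1$, independent of $f$, of the functions $u$ and of the balls, such that $\mathbb{K}_{\Omega,f}$ satisfies $PD(M,\gamma_P,\varepsilon_P,\eta_P)$.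
   Context: Quasi metric spaces. A quasi distance on a nonempty set $Y$ is a function $d:Y\times Y\to[0,+\infty[$ that is symmetric, satisfies $d(x,y)=0$ iff $x=y$, and $d(x,y)\le K(d(x,z)+d(z,y))$ for all $x,y,z$, with a constant $K\ge1$. Balls are $B_r(x)=\{y\in Y:d(x,y)<r\}$; $Y$ carries the topology for which the balls form a basis of neighborhoods. $d$ is Hölder continuous if there are $\beta>0$ and $0<\alpha\le1$ with $|d(x,y)-d(x,z)|\le\beta\, d(y,z)^\alpha(d(x,y)+d(x,z))^{1-\alpha}$ for all $x,y,z\in Y$. A positive measure $\mu$ on a $\sigma$-algebra containing the balls is doubling if $0<\mu(B_{2r}(x))\le C_D\,\mu(B_r(x))<\infty$ for all $x\in Y$, $r>0$. $(Y,d,\mu)$ is a Hölder doubling quasi metric space if $d$ is a Hölder continuous quasi distance and $\mu$ is doubling. Ring condition: there is a nonnegative function $\omega$ with $\omega(s)\to0$ as $s\to0^+$ such that for every ball $B_r(x)$ and all sufficiently small $s>0$, $\mu(B_r(x)\setminus B_{(1-s)r}(x))\le\omega(s)\mu(B_r(x))$. The function $\mathcal{S}_\Omega$. Let $\mathcal{B}$ be the set of balls contained in $\Omega$ and $\mathcal{F}(\Omega)$ the set of measurable functions $f:\Omega\to\mathbb{R}$. A function $\mathcal{S}_\Omega:\mathcal{B}\times\mathcal{F}(\Omega)\to[0,+\infty[$ is fixed such that $\mathcal{S}_\Omega(B_r(y),f)\le\mathcal{S}_\Omega(B_R(x),f)$ whenever $B_r(y)\subseteq B_R(x)$, and $\mathcal{S}_\Omega(B,\lambda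 f)=|\lambda|\,\mathcal{S}_\Omega(B,f)$ for all $\lambda\in\mathbb{R}$. $\mathcal{L}(\Omega)$ is the set of $f\in\mathcal{F}(\Omega)$ with $\mathcal{S}_\Omega(B,f)<+\infty$ for all $B\in\mathcal{B}$. The families. For each $f\in\mathcal{L}(\Omega)$, $\mathbb{K}_{\Omega,f}$ is a family of nonnegative measurable functions $u:A\to\mathbb{R}$ with domains $A\subset\Omega$, such that: if $u\in\mathbb{K}_{\Omega,f}$ then $\lambda u\in\mathbb{K}_{\Omega,\lambda f}$ for all $\lambda\ge0$; and if $u\in\mathbb{K}_{\Omega,f}$ and $\lambda,\tau\ge0$ are such that $\tau-\lambda u\ge0$, then $\tau-\lambda u\in\mathbb{K}_{\Omega,-\lambda f}$. $u\in\mathbb{K}_{\Omega,f}(A)$ means $u\in\mathbb{K}_{\Omega,f}$ and the domain of $u$ contains $A$. In the following properties all balls have the same (arbitrary) center. $CD(\nu,c,\varepsilon,\eta)$ (critical density): for every ball $B_{\eta R}\subset\Omega$ and every $u\in\mathbb{K}_{\Omega,f}(B_{\eta R})$ with $\mu(\{x\in B_R:u(x)\ge1\})\ge\nu\mu(B_R)$, one has $\inf_{B_{R/2}}u\ge c$ or $\mathcal{S}_\Omega(B_{\eta R},f)\ge\varepsilon$. $DB(\gamma,\varepsilon,\eta)$ (double ball): for every ball $B_{\eta R}\subset\Omega$ and every $u\in\mathbb{K}_{\Omega,f}(B_{\eta R})$ with $\inf_{B_{R/2}}u\ge1$ and $\mathcal{S}_\Omega(B_{\eta R},f)<\varepsilon$,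 one has $\inf_{B_R}u\ge\gamma$. $PD(M,\gamma_P,\varepsilon_P,\eta_P)$ (power decay): for every ball $B_{\eta_PR}\subset\Omega$ and every $u\in\mathbb{K}_{\Omega,f}(B_{\eta_PR})$ with $\inf_{B_R}u\le1$ and $\mathcal{S}_\Omega(B_{\eta_PR},f)<\varepsilon_P$, one has $\mu(\{x\in B_{R/2}:u(x)>M^k\})\le\gamma_P^k\,\mu(B_{R/2})$ for every $k\in\mathbb{N}$.
   Formalization: The measure is additionally assumed regular: each measurable set lies in a set of equal measure from the σ-algebra generated by the balls (true for Borel measures and completions); for arbitrary σ-algebras containing the balls the claim fails. *)

theory Defs
  imports "HOL-Analysis.Analysis" "HOL-Library.Landau_Symbols"
begin

(* The space Y is the whole type 'a. The topology and the sigma-algebra come from d and M,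
   not from type classes on 'a. *)

definition qball :: "('a \<Rightarrow> 'a \<Rightarrow> real) \<Rightarrow> 'a \<Rightarrow> real \<Rightarrow> 'a set" where
  "qball d x r = {y. d x y < r}"

definition quasi_distance :: "('a \<Rightarrow> 'a \<Rightarrow> real) \<Rightarrow> bool" where
  "quasi_distance d \<longleftrightarrow>
     (\<forall>x y. 0 \<le> d x y) \<and>
     (\<forall>x y. d x y = d y x) \<and>
     (\<forall>x y. d x y = 0 \<longleftrightarrow> x = y) \<and>
     (\<exists>K\<ge>1. \<forall>x y z. d x y \<le> K * (d x z + d z y))"

(* For \<alpha> = 1 the library value 0 powr 0 = 0 is harmless: the base d x y + d x z
   vanishes only for x = y = z, where the left-hand side is 0 as well. *)
definition hoelder_continuous :: "('a \<Rightarrow> 'a \<Rightarrow> real) \<Rightarrow> bool" where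
  "hoelder_continuous d \<longleftrightarrow>
     (\<exists>\<beta> \<alpha>. 0 < \<beta> \<and> 0 < \<alpha> \<and> \<alpha> \<le> 1 \<and>
        (\<forall>x y z. \<bar>d x y - d x z\<bar> \<le> \<beta> * d y z powr \<alpha> * (d x y + d x z) powr (1 - \<alpha>)))"

definition qopen :: "('a \<Rightarrow> 'a \<Rightarrow> real) \<Rightarrow> 'a set \<Rightarrow> bool" where
  "qopen d U \<longleftrightarrow> (\<forall>x\<in>U. \<exists>r>0. qball d x r \<subseteq> U)"

definition doubling :: "('a \<Rightarrow> 'a \<Rightarrow> real) \<Rightarrow> 'a measure \<Rightarrow> real \<Rightarrow> bool" where
  "doubling d M C\<^sub>D \<longleftrightarrow>
     (\<forall>x. \<forall>r>0. 0 < emeasure M (qball d x (2 * r)) \<and>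
        emeasure M (qball d x (2 * r)) \<le> ennreal C\<^sub>D * emeasure M (qball d x r) \<and>
        ennreal C\<^sub>D * emeasure M (qball d x r) < \<infinity>)"

definition hoelder_doubling_space :: "('a \<Rightarrow> 'a \<Rightarrow> real) \<Rightarrow> 'a measure \<Rightarrow> real \<Rightarrow> bool" where
  "hoelder_doubling_space d M C\<^sub>D \<longleftrightarrow>
     quasi_distance d \<and> hoelder_continuous d \<and>
     space M = UNIV \<and> (\<forall>x. \<forall>r>0. qball d x r \<in> sets M) \<and>
     doubling d M C\<^sub>D"

(* Regularity with respect to the sigma-algebra generated by the balls. It holds trivially if
   sets M is that sigma-algebra, and also if M is the completion of such a measure. Without it
   Lebesgue's differentiation theorem can fail: extend Lebesgue measure on the line to a
   sigma-algebra containing a set that occupies exactly half of every interval. *)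
definition ball_regular :: "('a \<Rightarrow> 'a \<Rightarrow> real) \<Rightarrow> 'a measure \<Rightarrow> bool" where
  "ball_regular d M \<longleftrightarrow>
     (\<forall>A\<in>sets M. \<exists>B\<in>sigma_sets UNIV {qball d x r | x r. 0 < r}.
        B \<in> sets M \<and> A \<subseteq> B \<and> emeasure M B = emeasure M A)"

(* How small s must be may depend on the ball; \<omega> may not. *)
definition ring_condition :: "('a \<Rightarrow> 'a \<Rightarrow> real) \<Rightarrow> 'a measure \<Rightarrow> (real \<Rightarrow> real) \<Rightarrow> bool" where
  "ring_condition d M \<omega> \<longleftrightarrow>
     (\<forall>s>0. 0 \<le> \<omega> s) \<and> (\<omega> \<longlongrightarrow> 0) (at_right 0) \<and>
     (\<forall>x. \<forall>r>0. \<forall>\<^sub>F s in at_right 0.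
        measure M (qball d x r - qball d x ((1 - s) * r)) \<le> \<omega> s * measure M (qball d x r))"

(* A real function with a given domain is a partial map, so A and the values on A are all
   there is to a function on A. *)

definition meas_pfun :: "'a measure \<Rightarrow> ('a \<rightharpoonup> real) \<Rightarrow> bool" where
  "meas_pfun M g \<longleftrightarrow> (\<lambda>x. the (g x)) \<in> borel_measurable (restrict_space M (dom g))"

definition scale_pfun :: "real \<Rightarrow> ('a \<rightharpoonup> real) \<Rightarrow> ('a \<rightharpoonup> real)" where
  "scale_pfun l g = (\<lambda>x. map_option (\<lambda>t. l * t) (g x))"

(* A real infimum. It is used only for nonnegative u and nonempty B contained in dom u. *)
definition inf_on :: "'a set \<Rightarrow> ('a \<rightharpoonup> real) \<Rightarrow> real" where
  "inf_on B u = (INF x\<in>B. the (u x))"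

definition balls_in :: "('a \<Rightarrow> 'a \<Rightarrow> real) \<Rightarrow> 'a set \<Rightarrow> 'a set set" where
  "balls_in d \<Omega> = {qball d x r | x r. 0 < r \<and> qball d x r \<subseteq> \<Omega>}"

definition meas_funs :: "'a measure \<Rightarrow> 'a set \<Rightarrow> ('a \<rightharpoonup> real) set" where
  "meas_funs M \<Omega> = {f. dom f = \<Omega> \<and> meas_pfun M f}"

(* S may take the value \<infinity>, since otherwise the finiteness condition defining fin_funs
   would be void. In the homogeneity clause 0 * \<infinity> = 0. *)
definition S_function ::
    "('a \<Rightarrow> 'a \<Rightarrow> real) \<Rightarrow> 'a measure \<Rightarrow> 'a set \<Rightarrow> ('a set \<Rightarrow> ('a \<rightharpoonup> real) \<Rightarrow> ennreal) \<Rightarrow> bool" where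
  "S_function d M \<Omega> S \<longleftrightarrow>
     (\<forall>f\<in>meas_funs M \<Omega>. \<forall>B\<in>balls_in d \<Omega>. \<forall>B'\<in>balls_in d \<Omega>. B \<subseteq> B' \<longrightarrow> S B f \<le> S B' f) \<and>
     (\<forall>f\<in>meas_funs M \<Omega>. \<forall>B\<in>balls_in d \<Omega>. \<forall>l. S B (scale_pfun l f) = ennreal \<bar>l\<bar> * S B f)"

definition fin_funs ::
    "('a \<Rightarrow> 'a \<Rightarrow> real) \<Rightarrow> 'a measure \<Rightarrow> 'a set \<Rightarrow> ('a set \<Rightarrow> ('a \<rightharpoonup> real) \<Rightarrow> ennreal) \<Rightarrow> ('a \<rightharpoonup> real) set" where
  "fin_funs d M \<Omega> S = {f \<in> meas_funs M \<Omega>. \<forall>B\<in>balls_in d \<Omega>. S B f < \<infinity>}"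

definition K_families ::
    "('a \<Rightarrow> 'a \<Rightarrow> real) \<Rightarrow> 'a measure \<Rightarrow> 'a set \<Rightarrow> ('a set \<Rightarrow> ('a \<rightharpoonup> real) \<Rightarrow> ennreal) \<Rightarrow>
      (('a \<rightharpoonup> real) \<Rightarrow> ('a \<rightharpoonup> real) set) \<Rightarrow> bool" where
  "K_families d M \<Omega> S \<K> \<longleftrightarrow>
     (\<forall>f\<in>fin_funs d M \<Omega> S. \<forall>u\<in>\<K> f.
        dom u \<subseteq> \<Omega> \<and> meas_pfun M u \<and> (\<forall>t\<in>ran u. 0 \<le> t) \<and>
        (\<forall>l\<ge>0. scale_pfun l u \<in> \<K> (scale_pfun l f)) \<and>
        (\<forall>l\<ge>0. \<forall>\<tau>\<ge>0. (\<forall>t\<in>ran u. 0 \<le> \<tau> - l * t) \<longrightarrow>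
           (\<lambda>x. map_option (\<lambda>t. \<tau> - l * t) (u x)) \<in> \<K> (scale_pfun (- l) f)))"

definition critical_density ::
    "('a \<Rightarrow> 'a \<Rightarrow> real) \<Rightarrow> 'a measure \<Rightarrow> 'a set \<Rightarrow> ('a set \<Rightarrow> ('a \<rightharpoonup> real) \<Rightarrow> ennreal) \<Rightarrow>
      (('a \<rightharpoonup> real) \<Rightarrow> ('a \<rightharpoonup> real) set) \<Rightarrow> ('a \<rightharpoonup> real) \<Rightarrow> real \<Rightarrow> real \<Rightarrow> real \<Rightarrow> real \<Rightarrow> bool" where
  "critical_density d M \<Omega> S \<K> f \<nu> c \<epsilon> \<eta> \<longleftrightarrow>
     (\<forall>z. \<forall>R>0. \<forall>u\<in>\<K> f.
        qball d z (\<eta> * R) \<subseteq> \<Omega> \<longrightarrow> qball d z (\<eta> * R) \<subseteq> dom u \<longrightarrow>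
        measure M {x \<in> qball d z R. 1 \<le> the (u x)} \<ge> \<nu> * measure M (qball d z R) \<longrightarrow>
        inf_on (qball d z (R / 2)) u \<ge> c \<or> S (qball d z (\<eta> * R)) f \<ge> ennreal \<epsilon>)"

definition double_ball ::
    "('a \<Rightarrow> 'a \<Rightarrow> real) \<Rightarrow> 'a set \<Rightarrow> ('a set \<Rightarrow> ('a \<rightharpoonup> real) \<Rightarrow> ennreal) \<Rightarrow>
      (('a \<rightharpoonup> real) \<Rightarrow> ('a \<rightharpoonup> real) set) \<Rightarrow> ('a \<rightharpoonup> real) \<Rightarrow> real \<Rightarrow> real \<Rightarrow> real \<Rightarrow> bool" where
  "double_ball d \<Omega> S \<K> f \<gamma> \<epsilon> \<eta> \<longleftrightarrow>
     (\<forall>z. \<forall>R>0. \<forall>u\<in>\<K> f.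
        qball d z (\<eta> * R) \<subseteq> \<Omega> \<longrightarrow> qball d z (\<eta> * R) \<subseteq> dom u \<longrightarrow>
        inf_on (qball d z (R / 2)) u \<ge> 1 \<longrightarrow> S (qball d z (\<eta> * R)) f < ennreal \<epsilon> \<longrightarrow>
        inf_on (qball d z R) u \<ge> \<gamma>)"

definition power_decay ::
    "('a \<Rightarrow> 'a \<Rightarrow> real) \<Rightarrow> 'a measure \<Rightarrow> 'a set \<Rightarrow> ('a set \<Rightarrow> ('a \<rightharpoonup> real) \<Rightarrow> ennreal) \<Rightarrow>
      (('a \<rightharpoonup> real) \<Rightarrow> ('a \<rightharpoonup> real) set) \<Rightarrow> ('a \<rightharpoonup> real) \<Rightarrow> real \<Rightarrow> real \<Rightarrow> real \<Rightarrow> real \<Rightarrow> bool" where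
  "power_decay d M \<Omega> S \<K> f C \<gamma> \<epsilon> \<eta> \<longleftrightarrow>
     (\<forall>z. \<forall>R>0. \<forall>u\<in>\<K> f.
        qball d z (\<eta> * R) \<subseteq> \<Omega> \<longrightarrow> qball d z (\<eta> * R) \<subseteq> dom u \<longrightarrow>
        inf_on (qball d z R) u \<le> 1 \<longrightarrow> S (qball d z (\<eta> * R)) f < ennreal \<epsilon> \<longrightarrow>
        (\<forall>k::nat. measure M {x \<in> qball d z (R / 2). the (u x) > C ^ k}
           \<le> \<gamma> ^ k * measure M (qball d z (R / 2))))"

end

theory Submission
  imports Defs
begin

text \<open>
  Let \<open>u\<close> have infimum at most \<open>1\<close> on \<open>B\<^sub>R\<close>. If \<open>{u \<ge> t}\<close> has density at least \<open>\<nu>\<close> in a ball,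
  then critical density followed by \<open>i + 1\<close> uses of the double ball property gives
  \<open>u \<ge> c \<gamma>\<^sup>i\<^sup>+\<^sup>1 t\<close> on its dilation by \<open>2\<^sup>i\<close>; by homogeneity, \<open>S < \<epsilon>\<close> is
  small enough for all these steps as long as \<open>c \<gamma>\<^sup>i t \<ge> 1\<close>. Taking \<open>t = b\<^sup>k\<close> with
  \<open>b\<close> large, a ball of radius comparable to \<open>2\<^sup>-\<^sup>k R\<close> therefore cannot have density \<open>\<nu>\<close>, as
  otherwise \<open>u > 1\<close> on \<open>B\<^sub>R\<close>. So around almost every point of \<open>{u > b\<^sup>k}\<close> there is a ball in which the
  density has just dropped below \<open>\<nu>\<close>, while it is at least \<open>\<nu>\<close> in the ball of half the radius; the
  former lies in \<open>{u > b\<^sup>k\<^sup>-\<^sup>1}\<close>. By Vitali's covering argument \<open>{u > b\<^sup>k}\<close> then has measure at most a constant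
  times that of \<open>{u > b\<^sup>k\<^sup>-\<^sup>1} - {u > b\<^sup>k}\<close>, that is, a fixed fraction of the measure of
  \<open>{u > b\<^sup>k\<^sup>-\<^sup>1}\<close>. The balls stick out by a geometrically decaying amount because \<open>d\<close> is
  Hoelder continuous, so it is enough to shrink the radius from \<open>R\<close> to \<open>R / 2\<close> geometrically.
  In case (B) the double ball property follows from critical density and doubling.
\<close>

section \<open>Vitali selection and sums over disjoint families\<close>

text \<open>In use the sets are balls of radius \<open>s / 2 ^ j x\<close>, so a smaller index means
  a larger ball. Zorn's lemma yields a maximal admissible disjoint subfamily; a set missed by it,
  taken with least index, could be added, so none is missed.\<close>

lemma vitali_selection:
  fixes B :: "'i \<Rightarrow> 'a set" and j :: "'i \<Rightarrow> nat"
  assumes ne: "\<And>x. x \<in> Z \<Longrightarrow> B x \<noteq> {}"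
  obtains C where "C \<subseteq> Z" "disjoint_family_on B C"
    "\<And>x. x \<in> Z \<Longrightarrow> \<exists>y\<in>C. j y \<le> j x \<and> B x \<inter> B y \<noteq> {}"
proof -
  \<comment> \<open>Imposing the index bound only on sets that already meet \<open>C\<close> makes
    the empty family admissible and lets the condition pass to unions of chains.\<close>
  define \<A> where "\<A> = {C. C \<subseteq> Z \<and> disjoint_family_on B C \<and>
     (\<forall>x\<in>Z. (\<exists>y\<in>C. B x \<inter> B y \<noteq> {}) \<longrightarrow> (\<exists>y\<in>C. j y \<le> j x \<and> B x \<inter> B y \<noteq> {}))}"
  have ch: "\<Union>\<C> \<in> \<A>" if c: "\<C> \<noteq> {}" "subset.chain \<A> \<C>" for \<C>
  proof -
    have sub: "\<C> \<subseteq> \<A>" and lin: "\<And>X Y. X \<in> \<C> \<Longrightarrow> Y \<in> \<C> \<Longrightarrow> X \<subseteq> Y \<or> Y \<subseteq> X"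
      using c(2) by (auto simp: subset_chain_def)
    have "disjoint_family_on B (\<Union>\<C>)"
      unfolding disjoint_family_on_def
    proof (intro ballI impI)
      fix x y assume "x \<in> \<Union>\<C>" "y \<in> \<Union>\<C>" "x \<noteq> y"
      then obtain X Y where XY: "X \<in> \<C>" "Y \<in> \<C>" "x \<in> X" "y \<in> Y" by auto
      obtain D where D: "D \<in> \<C>" "x \<in> D" "y \<in> D" using lin[OF XY(1,2)] XY by blast
      then have "disjoint_family_on B D" using sub by (auto simp: \<A>_def)
      then show "B x \<inter> B y = {}" using D \<open>x \<noteq> y\<close> by (auto simp: disjoint_family_on_def)
    qed
    moreover have "\<exists>y\<in>\<Union>\<C>. j y \<le> j x \<and> B x \<inter> B y \<noteq> {}"
      if xy: "x \<in> Z" "y \<in> \<Union>\<C>" "B x \<inter> B y \<noteq> {}" for x y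
    proof -
      obtain X where X: "X \<in> \<C>" "y \<in> X" using xy(2) by auto
      then have "X \<in> \<A>" using sub by auto
      then have "\<exists>y\<in>X. j y \<le> j x \<and> B x \<inter> B y \<noteq> {}" using xy X unfolding \<A>_def by blast
      then show ?thesis using X by blast
    qed
    ultimately show ?thesis using sub unfolding \<A>_def by blast
  qed
  have "{} \<in> \<A>" by (auto simp: \<A>_def disjoint_family_on_def)
  then have "\<exists>C\<in>\<A>. \<forall>X\<in>\<A>. C \<subseteq> X \<longrightarrow> X = C"
    using ch by (intro subset_Zorn_nonempty) auto
  then obtain C where C: "C \<in> \<A>" and max: "\<And>X. X \<in> \<A> \<Longrightarrow> C \<subseteq> X \<Longrightarrow> X = C" by blast
  have meet: "\<exists>y\<in>C. B x \<inter> B y \<noteq> {}" if x: "x \<in> Z" for x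
  proof (rule ccontr)
    assume "\<not> ?thesis"
    then have "x \<in> Z \<and> (\<forall>y\<in>C. B x \<inter> B y = {})" using x by auto
    from ex_has_least_nat[of "\<lambda>x. x \<in> Z \<and> (\<forall>y\<in>C. B x \<inter> B y = {})", OF this, of j]
    obtain w where w: "w \<in> Z" "\<forall>y\<in>C. B w \<inter> B y = {}"
      and wmin: "\<And>v. v \<in> Z \<Longrightarrow> \<forall>y\<in>C. B v \<inter> B y = {} \<Longrightarrow> j w \<le> j v"
      by blast
    have "disjoint_family_on B (insert w C)"
      using C w by (auto simp: \<A>_def disjoint_family_on_def)
    moreover have "\<exists>y\<in>insert w C. j y \<le> j v \<and> B v \<inter> B y \<noteq> {}"
      if v: "v \<in> Z" "\<exists>y\<in>insert w C. B v \<inter> B y \<noteq> {}" for v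
    proof (cases "\<exists>y\<in>C. B v \<inter> B y \<noteq> {}")
      case True
      then have "\<exists>y\<in>C. j y \<le> j v \<and> B v \<inter> B y \<noteq> {}" using C v(1) unfolding \<A>_def by blast
      then show ?thesis by blast
    next
      case False
      then have "j w \<le> j v" using wmin v(1) by blast
      moreover have "B v \<inter> B w \<noteq> {}" using False v(2) by blast
      ultimately show ?thesis by blast
    qed
    ultimately have "insert w C \<in> \<A>" using C w(1) unfolding \<A>_def by blast
    then have "w \<in> C" using max[of "insert w C"] by blast
    then show False using w ne[OF w(1)] by auto
  qed
  show ?thesis
  proof
    show "C \<subseteq> Z" "disjoint_family_on B C" using C by (auto simp: \<A>_def)
    show "\<exists>y\<in>C. j y \<le> j x \<and> B x \<inter> B y \<noteq> {}" if "x \<in> Z" for x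
      using meet[OF that] that C unfolding \<A>_def by blast
  qed
qed

text \<open>Finite sums of the measures are bounded by that of \<open>W\<close>, so the family is
  summable and has only countably many nonzero terms.\<close>

lemma countable_disjoint_positive:
  fixes Y :: "'i \<Rightarrow> 'a set"
  assumes Y: "\<And>i. i \<in> I \<Longrightarrow> Y i \<in> sets M" "\<And>i. i \<in> I \<Longrightarrow> 0 < measure M (Y i)"
    and disj: "disjoint_family_on Y I"
    and W: "W \<in> fmeasurable M" "\<And>i. i \<in> I \<Longrightarrow> Y i \<subseteq> W"
  shows "countable I"
proof -
  have fm: "Y i \<in> fmeasurable M" if "i \<in> I" for i
    using W Y(1) that by (metis fmeasurableI2)
  have "sum (\<lambda>i. measure M (Y i)) F \<le> measure M W" if F: "F \<subseteq> I" "finite F" for F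
  proof -
    have "sum (\<lambda>i. measure M (Y i)) F = measure M (\<Union>i\<in>F. Y i)"
      using F fm by (intro measure_UNION'[symmetric])
        (use disj in \<open>auto simp: disjoint_family_on_def pairwise_def disjnt_def subset_iff\<close>)
    also have "\<dots> \<le> measure M W"
      using F W Y(1) by (intro measure_mono_fmeasurable) (auto intro!: sets.finite_UN)
    finally show ?thesis .
  qed
  then have "(\<lambda>i. measure M (Y i)) summable_on I"
    by (intro nonneg_bdd_above_summable_on) (auto intro!: bdd_aboveI)
  then have "countable {i\<in>I. measure M (Y i) \<noteq> 0}"
    by (intro abs_summable_countable) auto
  also have "{i\<in>I. measure M (Y i) \<noteq> 0} = I" using Y(2) by force
  finally show ?thesis .
qed

text \<open>Countable subadditivity for \<open>X\<close> is combined with countable additivity for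
  \<open>Y\<close>. \<open>P\<close> and \<open>Q\<close> reindex by the naturals, with empty sets
  off the range of the enumeration.\<close>

lemma emeasure_UN_le_disjoint_UN:
  fixes X Y :: "'i \<Rightarrow> 'a set"
  assumes I: "countable I"
    and X: "\<And>i. i \<in> I \<Longrightarrow> X i \<in> sets M" and Y: "\<And>i. i \<in> I \<Longrightarrow> Y i \<in> sets M"
    and disj: "disjoint_family_on Y I"
    and le: "\<And>i. i \<in> I \<Longrightarrow> emeasure M (X i) \<le> c * emeasure M (Y i)"
  shows "emeasure M (\<Union>i\<in>I. X i) \<le> c * emeasure M (\<Union>i\<in>I. Y i)"
proof -
  define f where "f = to_nat_on I"
  define g where "g = from_nat_into I"
  have gf: "g (f i) = i" if "i \<in> I" for i
    using that I by (simp add: f_def g_def)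
  define P where "P n = (if n \<in> f ` I then X (g n) else {})" for n
  define Q where "Q n = (if n \<in> f ` I then Y (g n) else {})" for n
  have PQ: "(\<Union>i\<in>I. X i) = (\<Union>n. P n)" "(\<Union>i\<in>I. Y i) = (\<Union>n. Q n)"
    by (auto simp: P_def Q_def gf split: if_splits)
  have m: "range P \<subseteq> sets M" "range Q \<subseteq> sets M"
    using X Y by (auto simp: P_def Q_def gf)
  have dQ: "disjoint_family Q"
    unfolding disjoint_family_on_def
  proof (intro ballI impI)
    fix m n :: nat assume "m \<noteq> n"
    show "Q m \<inter> Q n = {}"
    proof (cases "m \<in> f ` I \<and> n \<in> f ` I")
      case True
      then obtain a b where ab: "a \<in> I" "b \<in> I" "m = f a" "n = f b" by blast
      then have "a \<noteq> b" using \<open>m \<noteq> n\<close> by auto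
      then have "Y a \<inter> Y b = {}" using ab disjoint_family_onD[OF disj] by blast
      then show ?thesis using ab by (simp add: Q_def gf)
    qed (auto simp: Q_def)
  qed
  have "emeasure M (\<Union>n. P n) \<le> (\<Sum>n. emeasure M (P n))"
    by (rule emeasure_subadditive_countably[OF m(1)])
  also have "\<dots> \<le> (\<Sum>n. c * emeasure M (Q n))"
    by (intro suminf_le) (auto simp: P_def Q_def gf le)
  also have "\<dots> = c * (\<Sum>n. emeasure M (Q n))" by (rule ennreal_suminf_cmult)
  also have "(\<Sum>n. emeasure M (Q n)) = emeasure M (\<Union>n. Q n)"
    by (rule suminf_emeasure[OF m(2) dQ])
  finally show ?thesis by (simp add: PQ)
qed

section \<open>Balls, their topology and regularity of finite measures\<close>

locale hoelder_space =
  fixes d :: "'a \<Rightarrow> 'a \<Rightarrow> real" and M :: "'a measure" and C\<^sub>D K \<beta> \<alpha> :: real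
  assumes nonneg [simp]: "0 \<le> d x y"
    and sym: "d x y = d y x"
    and zero_iff [simp]: "d x y = 0 \<longleftrightarrow> x = y"
    and K_ge_1: "1 \<le> K"
    and quasi_triangle: "d x y \<le> K * (d x z + d z y)"
    and beta_pos: "0 < \<beta>" and alpha_pos: "0 < \<alpha>" and alpha_le_1: "\<alpha> \<le> 1"
    and hoelder: "\<bar>d x y - d x z\<bar> \<le> \<beta> * d y z powr \<alpha> * (d x y + d x z) powr (1 - \<alpha>)"
    and space_M [simp]: "space M = UNIV"
    and qball_sets_pos: "0 < r \<Longrightarrow> qball d x r \<in> sets M"
    and doubling: "doubling d M C\<^sub>D"
    and ball_regular: "ball_regular d M"
begin

lemma qball_empty:
  assumes "r \<le> 0"
  shows "qball d x r = {}"
proof -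
  have "\<not> d x y < r" for y using nonneg[of x y] assms by linarith
  then show ?thesis by (simp add: qball_def)
qed

lemma qball_sets [measurable]: "qball d x r \<in> sets M"
  using qball_sets_pos[of r x] qball_empty[of r x] by (cases "0 < r") auto

lemma qball_mono: "r \<le> s \<Longrightarrow> qball d x r \<subseteq> qball d x s"
  by (auto simp: qball_def)

lemma center_in_qball: "0 < r \<Longrightarrow> x \<in> qball d x r"
  using zero_iff[of x x] by (simp add: qball_def del: zero_iff)

lemma dist_measurable [measurable]: "d x \<in> borel_measurable M"
  using qball_sets[of x] by (auto simp: borel_measurable_iff_less qball_def)

text \<open>Hoelder continuity is what makes balls and the sets \<open>{y. r < d x y}\<close> open.
  Its bound involves \<open>d x z\<close> itself, so the quasi triangle inequality first gives
  \<open>d x y + d x z \<le> D\<close> for \<open>d y z < 1\<close>.\<close>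

lemma dist_continuous:
  assumes "0 < e"
  obtains t where "0 < t" "\<And>z. d y z < t \<Longrightarrow> \<bar>d x y - d x z\<bar> < e"
proof -
  define D where "D = d x y + K * (d x y + 1) + 1"
  have D: "0 < D" unfolding D_def using K_ge_1 nonneg[of x y]
    by (smt (verit) mult_nonneg_nonneg)
  \<comment> \<open>With \<open>d y z powr \<alpha> \<le> a\<close> the Hoelder bound is at most
    \<open>e / 2\<close>; the cap at 1 in \<open>t\<close> keeps \<open>D\<close> valid.\<close>
  define a where "a = e / (2 * (\<beta> * D powr (1 - \<alpha>)))"
  have c: "0 < \<beta> * D powr (1 - \<alpha>)" using beta_pos D by simp
  have a: "0 < a" unfolding a_def using assms c by simp
  define t where "t = min 1 (a powr (1 / \<alpha>))"
  have t: "0 < t" using a by (simp add: t_def)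
  have "\<bar>d x y - d x z\<bar> < e" if z: "d y z < t" for z
  proof -
    have "d x z \<le> K * (d x y + d y z)" by (rule quasi_triangle)
    also have "\<dots> \<le> K * (d x y + 1)"
      using z K_ge_1 by (intro mult_left_mono) (auto simp: t_def)
    finally have dD: "d x y + d x z \<le> D" by (simp add: D_def)
    have "d y z powr \<alpha> \<le> (a powr (1 / \<alpha>)) powr \<alpha>"
      using z alpha_pos by (intro powr_mono2) (auto simp: t_def)
    also have "\<dots> = a" using a alpha_pos by (simp add: powr_powr)
    finally have 1: "d y z powr \<alpha> \<le> a" .
    have 2: "(d x y + d x z) powr (1 - \<alpha>) \<le> D powr (1 - \<alpha>)"
      using dD alpha_le_1 by (intro powr_mono2) auto
    have "\<bar>d x y - d x z\<bar> \<le> \<beta> * d y z powr \<alpha> * (d x y + d x z) powr (1 - \<alpha>)"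
      by (rule hoelder)
    also have "\<dots> \<le> \<beta> * a * D powr (1 - \<alpha>)"
      using 1 2 beta_pos a by (intro mult_mono) auto
    also have "\<dots> = e / 2" using beta_pos D by (simp add: a_def)
    also have "\<dots> < e" using assms by simp
    finally show ?thesis .
  qed
  then show ?thesis using t that by blast
qed

lemma qopen_qball: "qopen d (qball d x r)"
  unfolding qopen_def
proof
  fix y assume "y \<in> qball d x r"
  then have "0 < r - d x y" by (simp add: qball_def)
  then obtain t where t: "0 < t" "\<And>z. d y z < t \<Longrightarrow> \<bar>d x y - d x z\<bar> < r - d x y"
    using dist_continuous[where x = x and y = y] by blast
  then show "\<exists>t>0. qball d y t \<subseteq> qball d x r"
    by (intro exI[of _ t]) (force simp: qball_def)
qed

lemma qopen_far: "qopen d {y. r < d x y}"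
  unfolding qopen_def
proof
  fix y assume "y \<in> {y. r < d x y}"
  then have "0 < d x y - r" by simp
  then obtain t where t: "0 < t" "\<And>z. d y z < t \<Longrightarrow> \<bar>d x y - d x z\<bar> < d x y - r"
    using dist_continuous[where x = x and y = y] by blast
  then show "\<exists>t>0. qball d y t \<subseteq> {y. r < d x y}"
    by (intro exI[of _ t]) (force simp: qball_def)
qed

lemma qopen_Int: "qopen d U \<Longrightarrow> qopen d V \<Longrightarrow> qopen d (U \<inter> V)"
  unfolding qopen_def
proof
  fix x assume U: "\<forall>x\<in>U. \<exists>r>0. qball d x r \<subseteq> U" and V: "\<forall>x\<in>V. \<exists>r>0. qball d x r \<subseteq> V"
    and x: "x \<in> U \<inter> V"
  obtain r s where "0 < r" "qball d x r \<subseteq> U" "0 < s" "qball d x s \<subseteq> V" using U V x by blast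
  then show "\<exists>r>0. qball d x r \<subseteq> U \<inter> V"
    using qball_mono[of "min r s" r x] qball_mono[of "min r s" s x]
    by (intro exI[of _ "min r s"]) auto
qed

lemma qopen_UN: "(\<And>i. i \<in> I \<Longrightarrow> qopen d (U i)) \<Longrightarrow> qopen d (\<Union>i\<in>I. U i)"
  unfolding qopen_def by (meson UN_E UN_upper subset_trans)

lemma qopen_UNIV: "qopen d UNIV"
  unfolding qopen_def using zero_less_one by blast

lemma qopen_INT_lessThan:
  fixes n :: nat
  shows "(\<And>i. qopen d (V i)) \<Longrightarrow> qopen d (\<Inter>i<n. V i)"
proof (induction n)
  case 0
  show ?case by (simp add: qopen_UNIV)
next
  case (Suc n)
  then show ?case by (simp add: lessThan_Suc qopen_Int)
qed

text \<open>The closed set \<open>F \<subseteq> A\<close> of the usual formulation is \<open>- V\<close>, which makes the property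
  visibly stable under complements.\<close>

lemma finite_measure_regular:
  assumes N: "finite_measure N" "sets N = sets M"
    and A: "A \<in> sigma_sets UNIV {qball d x r | x r. 0 < r}" and e: "0 < e"
  shows "\<exists>U V. qopen d U \<and> qopen d V \<and> U \<in> sets M \<and> V \<in> sets M \<and> A \<subseteq> U \<and> - A \<subseteq> V \<and>
    measure N (U \<inter> V) < e"
  using A e
proof (induction arbitrary: e rule: sigma_sets.induct)
  case (Basic A)
  interpret finite_measure N by fact
  obtain x r where A: "A = qball d x r" "0 < r" using Basic by auto
  \<comment> \<open>These open sets contain the complement of the ball and meet the ball in shells
    that shrink to the empty set.\<close>
  define V where "V n = {y. r - 1 / real (Suc n) < d x y}" for n
  have V: "V n \<in> sets M" for n
  proof -
    have "{y\<in>space M. r - 1 / real (Suc n) < d x y} \<in> sets M" by measurable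
    then show ?thesis by (simp add: V_def)
  qed
  have cap: "(\<Inter>n. A \<inter> V n) = {}"
  proof (rule ccontr)
    assume "(\<Inter>n. A \<inter> V n) \<noteq> {}"
    then obtain y where y: "d x y < r" "\<And>n. r - 1 / real (Suc n) < d x y"
      by (auto simp: A qball_def V_def)
    then obtain n where "inverse (real (Suc n)) < r - d x y"
      using reals_Archimedean[of "r - d x y"] by auto
    then show False using y(2)[of n] by (simp add: inverse_eq_divide)
  qed
  have "decseq (\<lambda>n. A \<inter> V n)"
  proof (rule decseq_SucI)
    fix n
    have "1 / real (Suc (Suc n)) \<le> 1 / real (Suc n)" by (simp add: frac_le)
    then show "A \<inter> V (Suc n) \<subseteq> A \<inter> V n" by (auto simp: V_def)
  qed
  then have "(\<lambda>n. measure N (A \<inter> V n)) \<longlonglongrightarrow> measure N (\<Inter>n. A \<inter> V n)"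
    using V A N(2) by (intro finite_Lim_measure_decseq) auto
  then have "\<forall>\<^sub>F n in sequentially. measure N (A \<inter> V n) < e"
    unfolding cap using \<open>0 < e\<close> by (intro order_tendstoD(2)) auto
  then obtain n where n: "measure N (A \<inter> V n) < e" by (auto simp: eventually_sequentially)
  have "y \<in> V n" if "\<not> d x y < r" for y
  proof -
    have "r - 1 / real (Suc n) < r" by simp
    also have "\<dots> \<le> d x y" using that by simp
    finally show ?thesis by (simp add: V_def)
  qed
  then have "- A \<subseteq> V n" by (auto simp: A qball_def)
  moreover have "qopen d (V n)" unfolding V_def by (rule qopen_far)
  ultimately show ?case using n V[of n] qopen_qball[of x r] qball_sets[of x r]
    unfolding A(1) by blast
next
  case Empty
  then show ?case using sets.top[of M] qopen_UNIV
    by (intro exI[of _ "{}"] exI[of _ UNIV]) (simp add: qopen_def)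
next
  case (Compl A)
  then obtain U V where "qopen d U" "qopen d V" "U \<in> sets M" "V \<in> sets M" "A \<subseteq> U" "- A \<subseteq> V"
    "measure N (U \<inter> V) < e" by blast
  then have "- A \<subseteq> V" "- (- A) \<subseteq> U" "measure N (V \<inter> U) < e"
    by (simp_all add: Int_commute)
  with \<open>qopen d U\<close> \<open>qopen d V\<close> \<open>U \<in> sets M\<close> \<open>V \<in> sets M\<close> show ?case
    unfolding Compl_eq_Diff_UNIV[symmetric] by blast
next
  case (Union A)
  interpret finite_measure N by fact
  \<comment> \<open>The errors sum to \<open>e / 2\<close>; the other half is spent on replacing an
    infinite intersection by a finite one.\<close>
  define P where "P i U V \<longleftrightarrow> qopen d U \<and> qopen d V \<and> U \<in> sets M \<and> V \<in> sets M \<and> A i \<subseteq> U \<and>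
    - A i \<subseteq> V \<and> measure N (U \<inter> V) < (e / 2) * (1 / 2) ^ Suc i" for i U V
  have "\<exists>U V. P i U V" for i
    unfolding P_def using Union.prems by (intro Union.IH) auto
  then obtain U V where "\<And>i. P i (U i) (V i)" by metis
  then have UV: "\<And>i. qopen d (U i)" "\<And>i. qopen d (V i)"
    and m: "\<And>i. U i \<in> sets M" "\<And>i. V i \<in> sets M"
    and cov: "\<And>i. A i \<subseteq> U i" "\<And>i. - A i \<subseteq> V i"
    and small: "\<And>i. measure N (U i \<inter> V i) < (e / 2) * (1 / 2) ^ Suc i"
    by (auto simp: P_def)
  \<comment> \<open>The intersection of all \<open>V i\<close> need not be open. The finite ones
    are, and continuity from above shows that a large \<open>n\<close> is good enough.\<close>
  define W where "W n = (\<Inter>i<n. V i)" for n :: nat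
  have W: "W n \<in> sets M" for n
  proof (induction n)
    case 0 show ?case using sets.top[of M] by (simp add: W_def)
  next
    case (Suc n) then show ?case using m by (simp add: W_def lessThan_Suc)
  qed
  have UU: "(\<Union>i. U i) \<in> sets M" using m by auto
  have "decseq (\<lambda>n. (\<Union>i. U i) \<inter> W n)" by (rule decseq_SucI) (auto simp: W_def)
  then have lim: "(\<lambda>n. measure N ((\<Union>i. U i) \<inter> W n)) \<longlonglongrightarrow> measure N (\<Inter>n. (\<Union>i. U i) \<inter> W n)"
    using UU W N(2) by (intro finite_Lim_measure_decseq) auto
  have sums: "(\<lambda>i. (e / 2) * (1 / 2) ^ Suc i) sums (e / 2)"
    using sums_mult[OF power_half_series, of "e / 2"] by simp
  have summ: "summable (\<lambda>i. measure N (U i \<inter> V i))"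
    using small by (intro summable_comparison_test'[OF sums_summable[OF sums], of 0]) (auto simp: less_imp_le)
  have "measure N (\<Inter>n. (\<Union>i. U i) \<inter> W n) \<le> measure N (\<Union>i. U i \<inter> V i)"
  proof (rule finite_measure_mono)
    show "(\<Inter>n. (\<Union>i. U i) \<inter> W n) \<subseteq> (\<Union>i. U i \<inter> V i)"
    proof
      fix y assume y: "y \<in> (\<Inter>n. (\<Union>i. U i) \<inter> W n)"
      then obtain i where "y \<in> U i" by auto
      moreover have "y \<in> W (Suc i)" using y by blast
      then have "y \<in> V i" by (auto simp: W_def)
      ultimately show "y \<in> (\<Union>i. U i \<inter> V i)" by blast
    qed
  qed (use m N(2) in auto)
  also have "\<dots> \<le> (\<Sum>i. measure N (U i \<inter> V i))"
    using m N(2) summ by (intro finite_measure_subadditive_countably) auto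
  also have "\<dots> \<le> (\<Sum>i. (e / 2) * (1 / 2) ^ Suc i)"
    using summ sums_summable[OF sums] small by (intro suminf_le) (auto simp: less_imp_le)
  also have "\<dots> = e / 2" using sums by (simp add: sums_iff)
  also have "\<dots> < e" using Union.prems by simp
  finally have "\<forall>\<^sub>F n in sequentially. measure N ((\<Union>i. U i) \<inter> W n) < e"
    using lim by (intro order_tendstoD(2))
  then obtain n where n: "measure N ((\<Union>i. U i) \<inter> W n) < e" by (auto simp: eventually_sequentially)
  have "qopen d (W n)" unfolding W_def using UV by (intro qopen_INT_lessThan)
  moreover have "qopen d (\<Union>i. U i)" using UV by (intro qopen_UN)
  moreover have "(\<Union>i. A i) \<subseteq> (\<Union>i. U i)" "- (\<Union>i. A i) \<subseteq> W n" using cov unfolding W_def by blast+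
  ultimately show ?case using n UU W by blast
qed

section \<open>Consequences of doubling\<close>

lemma doubling_constant_pos: "0 < C\<^sub>D"
proof (rule ccontr)
  assume "\<not> 0 < C\<^sub>D"
  then have "ennreal C\<^sub>D = 0" by (simp add: ennreal_neg)
  moreover have "0 < emeasure M (qball d undefined (2 * 1)) \<and>
    emeasure M (qball d undefined (2 * 1)) \<le> ennreal C\<^sub>D * emeasure M (qball d undefined 1)"
    using doubling zero_less_one unfolding doubling_def by blast
  ultimately show False by auto
qed

lemma qball_fmeasurable [intro, simp]: "qball d x r \<in> fmeasurable M"
proof (cases "0 < r")
  case True
  then have "ennreal C\<^sub>D * emeasure M (qball d x r) < \<infinity>" using doubling unfolding doubling_def by blast
  then have "emeasure M (qball d x r) < \<infinity>"
    using doubling_constant_pos by (auto simp: ennreal_mult_less_top)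
  then show ?thesis by (intro fmeasurableI qball_sets)
qed (simp add: qball_empty)

lemma emeasure_qball: "emeasure M (qball d x r) = ennreal (measure M (qball d x r))"
  using qball_fmeasurable by (rule emeasure_eq_measure2)

lemma measure_qball_pos:
  assumes "0 < r"
  shows "0 < measure M (qball d x r)"
proof -
  have "0 < r / 2" using assms by simp
  then have "0 < emeasure M (qball d x (2 * (r / 2)))" using doubling unfolding doubling_def by blast
  then show ?thesis by (simp add: emeasure_qball)
qed

lemma measure_qball_double:
  assumes "0 < r"
  shows "measure M (qball d x (2 * r)) \<le> C\<^sub>D * measure M (qball d x r)"
proof -
  have "emeasure M (qball d x (2 * r)) \<le> ennreal C\<^sub>D * emeasure M (qball d x r)"
    using doubling assms unfolding doubling_def by blast
  then show ?thesis using doubling_constant_pos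
    by (simp add: emeasure_qball ennreal_mult[symmetric])
qed

lemma doubling_constant_ge_1: "1 \<le> C\<^sub>D"
proof -
  fix x :: 'a
  have "measure M (qball d x 1) \<le> measure M (qball d x (2 * 1))"
    by (intro measure_mono_fmeasurable qball_mono) auto
  also have "\<dots> \<le> C\<^sub>D * measure M (qball d x 1)" by (rule measure_qball_double) simp
  finally show ?thesis using measure_qball_pos[of 1 x] by simp
qed

lemma measure_qball_power:
  assumes "0 < r"
  shows "measure M (qball d x (2 ^ m * r)) \<le> C\<^sub>D ^ m * measure M (qball d x r)"
proof (induction m)
  case (Suc m)
  have "measure M (qball d x (2 ^ Suc m * r)) \<le> C\<^sub>D * measure M (qball d x (2 ^ m * r))"
    using measure_qball_double[of "2 ^ m * r" x] assms by (simp add: mult.assoc)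
  also have "\<dots> \<le> C\<^sub>D * (C\<^sub>D ^ m * measure M (qball d x r))"
    using Suc doubling_constant_pos by (intro mult_left_mono) auto
  finally show ?case by (simp add: mult.assoc)
qed simp

section \<open>Open approximation, coverings and density points\<close>

text \<open>\<open>ball_regular\<close> replaces \<open>A\<close> by a set \<open>B\<close> of the
  same measure generated by balls, to which regularity applies. The error is measured inside
  \<open>W\<close> because regularity was shown for finite measures, here the restriction of
  \<open>M\<close> to \<open>W\<close>.\<close>

lemma qopen_approximation:
  assumes A: "A \<in> fmeasurable M" and W: "W \<in> fmeasurable M" and e: "0 < e"
  shows "\<exists>U. qopen d U \<and> U \<in> sets M \<and> A \<subseteq> U \<and> measure M ((U - A) \<inter> W) < e"
proof -
  have [measurable]: "A \<in> sets M" "W \<in> sets M" using A W by auto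
  obtain B where B: "B \<in> sigma_sets UNIV {qball d x r | x r. 0 < r}" "A \<subseteq> B"
    and Bm [measurable]: "B \<in> sets M" and AB: "emeasure M B = emeasure M A"
    using ball_regular \<open>A \<in> sets M\<close> unfolding ball_regular_def by blast
  define N where "N = density M (indicator W)"
  have N: "sets N = sets M" by (simp add: N_def)
  have Nm: "measure N X = measure M (W \<inter> X)" if "X \<in> sets M" for X
    using that unfolding N_def by (intro measure_restricted) auto
  have "emeasure N (space N) \<noteq> \<infinity>"
    using W emeasure_restricted[OF \<open>W \<in> sets M\<close> sets.top[of M]] by (simp add: N_def fmeasurable_def)
  then have "finite_measure N" by (rule finite_measureI)
  from finite_measure_regular[OF this N B(1) e]
  obtain U V where U: "qopen d U" "U \<in> sets M" "V \<in> sets M" "B \<subseteq> U" "- B \<subseteq> V"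
    and UV: "measure N (U \<inter> V) < e" by blast
  have Bf: "B \<in> fmeasurable M" using AB A by (intro fmeasurableI) (auto simp: fmeasurable_def)
  have "measure M (B - A) = measure M B - measure M A"
    using A Bf B(2) by (intro measurable_measure_Diff) auto
  then have 0: "measure M (B - A) = 0" using AB by (simp add: measure_def)
  \<comment> \<open>Off the null set \<open>B - A\<close>, a point of \<open>U - A\<close> lies in
    \<open>- B\<close> and hence in \<open>V\<close>.\<close>
  have "measure M ((U - A) \<inter> W) \<le> measure M (W \<inter> (U \<inter> V) \<union> (B - A))"
    using U W Bf by (intro measure_mono_fmeasurable)
      (auto intro!: fmeasurable.Un fmeasurable_Int_fmeasurable fmeasurable_Diff)
  also have "\<dots> \<le> measure M (W \<inter> (U \<inter> V)) + measure M (B - A)"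
    using U by (intro measure_Un_le) auto
  also have "\<dots> < e" using UV Nm[of "U \<inter> V"] U 0 by auto
  finally show ?thesis using U B by blast
qed

text \<open>The coverings below have to catch only the centres of the balls, for which the
  enlargement by \<open>2 * K\<close> suffices.\<close>

lemma center_in_enlarged_qball:
  assumes "qball d x r \<inter> qball d y s \<noteq> {}" "r \<le> s"
  shows "x \<in> qball d y (2 * K * s)"
proof -
  obtain w where w: "d x w < r" "d y w < s" using assms(1) by (auto simp: qball_def)
  have "d y x \<le> K * (d y w + d w x)" by (rule quasi_triangle)
  also have "\<dots> < K * (s + s)"
    using w assms(2) K_ge_1 sym[of x w] by (intro mult_strict_left_mono) auto
  finally show ?thesis by (simp add: qball_def algebra_simps)
qed

text \<open>Each selected ball has more than the fraction \<open>1 - \<nu>\<close> of its measure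
  outside \<open>A\<close>, and these parts are disjoint subsets of \<open>W - A\<close>. The
  enlargement by \<open>2 * K \<le> 2 ^ m\<close> costs \<open>m\<close> doublings. \<open>Z\<close>
  may be nonmeasurable, hence the cover \<open>V\<close>.\<close>

lemma measure_cover_by_low_density_balls:
  fixes j :: "'a \<Rightarrow> nat"
  assumes s: "0 < s" and nu: "\<nu> < 1" and m: "2 * K \<le> 2 ^ m"
    and W: "W \<in> fmeasurable M" and A: "A \<in> sets M"
    and sub: "\<And>x. x \<in> Z \<Longrightarrow> qball d x (s / 2 ^ j x) \<subseteq> W"
    and low: "\<And>x. x \<in> Z \<Longrightarrow>
      measure M (A \<inter> qball d x (s / 2 ^ j x)) < \<nu> * measure M (qball d x (s / 2 ^ j x))"
  shows "\<exists>V\<in>fmeasurable M. Z \<subseteq> V \<and> measure M V \<le> C\<^sub>D ^ m / (1 - \<nu>) * measure M (W - A)"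
proof -
  define r where "r x = s / 2 ^ j x" for x
  define B where "B x = qball d x (r x)" for x
  have r: "0 < r x" for x using s by (simp add: r_def)
  obtain C where C: "C \<subseteq> Z" "disjoint_family_on B C"
    "\<And>x. x \<in> Z \<Longrightarrow> \<exists>y\<in>C. j y \<le> j x \<and> B x \<inter> B y \<noteq> {}"
    using vitali_selection[of Z B j] center_in_qball[OF r] unfolding B_def by blast
  define X where "X x = qball d x (2 * K * r x)" for x
  have cov: "Z \<subseteq> (\<Union>y\<in>C. X y)"
  proof
    fix x assume "x \<in> Z"
    then obtain y where y: "y \<in> C" "j y \<le> j x" "B x \<inter> B y \<noteq> {}" using C(3) by blast
    then have "r x \<le> r y" using s by (auto simp: r_def intro!: divide_left_mono)
    then show "x \<in> (\<Union>y\<in>C. X y)"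
      using y center_in_enlarged_qball[of x "r x" y "r y"] unfolding B_def X_def by blast
  qed
  have BW: "B x \<subseteq> W" if "x \<in> C" for x using sub C(1) that by (auto simp: B_def r_def)
  have cnt: "countable C"
    using C(2) W BW by (intro countable_disjoint_positive[of C B M W])
      (auto simp: B_def measure_qball_pos r)
  define c where "c = C\<^sub>D ^ m / (1 - \<nu>)"
  have c: "0 \<le> c" using nu doubling_constant_pos by (simp add: c_def)
  have le: "emeasure M (X x) \<le> ennreal c * emeasure M (B x - A)" if x: "x \<in> C" for x
  proof -
    have "measure M (X x) \<le> measure M (qball d x (2 ^ m * r x))"
      unfolding X_def using m r[of x] by (intro measure_mono_fmeasurable qball_mono mult_right_mono) auto
    also have "\<dots> \<le> C\<^sub>D ^ m * measure M (B x)" unfolding B_def by (rule measure_qball_power[OF r])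
    also have "measure M (B x) \<le> measure M (B x - A) / (1 - \<nu>)"
    proof -
      have AB: "A \<inter> B x \<in> fmeasurable M" using A fmeasurable_Int_fmeasurable[of "B x" M A]
        by (simp add: B_def Int_commute)
      have "measure M (B x - A) = measure M (B x) - measure M (A \<inter> B x)"
        using AB measurable_measure_Diff[of "B x" M "A \<inter> B x"]
        by (simp add: B_def fmeasurableD Diff_Int)
      moreover have "measure M (A \<inter> B x) < \<nu> * measure M (B x)"
        using low x C(1) by (auto simp: B_def r_def)
      ultimately show ?thesis using nu by (simp add: field_simps)
    qed
    finally have "measure M (X x) \<le> c * measure M (B x - A)"
      using doubling_constant_pos by (simp add: c_def)
    moreover have "emeasure M (B x - A) = ennreal (measure M (B x - A))"
      using A by (intro emeasure_eq_measure2 fmeasurable_Diff) (auto simp: B_def)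
    ultimately show ?thesis
      using c by (simp add: X_def emeasure_qball ennreal_mult[symmetric])
  qed
  have "emeasure M (\<Union>y\<in>C. X y) \<le> ennreal c * emeasure M (\<Union>y\<in>C. B y - A)"
    using cnt le A C(2) by (intro emeasure_UN_le_disjoint_UN)
      (auto simp: X_def B_def disjoint_family_on_def)
  also have "\<dots> \<le> ennreal c * emeasure M (W - A)"
    using BW W A by (intro mult_left_mono emeasure_mono) auto
  also have "\<dots> = ennreal (c * measure M (W - A))"
    using c W A by (simp add: ennreal_mult emeasure_eq_measure2 fmeasurable_Diff)
  finally have le2: "emeasure M (\<Union>y\<in>C. X y) \<le> ennreal (c * measure M (W - A))" .
  have "(\<Union>y\<in>C. X y) \<in> fmeasurable M"
    using cnt le2 by (intro fmeasurableI sets.countable_UN') (auto simp: X_def intro: le_less_trans)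
  moreover from this have "measure M (\<Union>y\<in>C. X y) \<le> c * measure M (W - A)"
    using le2 c by (simp add: emeasure_eq_measure2)
  ultimately show ?thesis using cov unfolding c_def by blast
qed

text \<open>A weak Lebesgue density theorem along the radii \<open>s / 2 ^ j\<close>. For an open
  \<open>U\<close> around \<open>A\<close> with little excess, the small balls of low density stay
  in \<open>U\<close>, so the covering bound involves only that excess.\<close>

lemma low_density_points_negligible:
  assumes A: "A \<in> sets M" "A \<subseteq> qball d z \<rho>" and s: "0 < s" and nu: "\<nu> < 1" and e: "0 < e"
  defines "N \<equiv> {x\<in>A. \<exists>J::nat. \<forall>j\<ge>J. measure M (A \<inter> qball d x (s / 2 ^ j))
      < \<nu> * measure M (qball d x (s / 2 ^ j))}"
  shows "\<exists>V\<in>fmeasurable M. N \<subseteq> V \<and> measure M V < e"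
proof -
  obtain m :: nat where m: "2 * K \<le> 2 ^ m" using real_arch_pow[of 2 "2 * K"] by (auto intro: less_imp_le)
  define c where "c = C\<^sub>D ^ m / (1 - \<nu>)"
  have c: "0 < c" using nu doubling_constant_pos by (simp add: c_def)
  have Af: "A \<in> fmeasurable M" using A by (meson fmeasurableI2 qball_fmeasurable)
  have "0 < e / c" using e c by simp
  from qopen_approximation[OF Af qball_fmeasurable this]
  obtain U where U: "qopen d U" "U \<in> sets M" "A \<subseteq> U"
    and small: "measure M ((U - A) \<inter> qball d z \<rho>) < e / c" by blast
  define W where "W = U \<inter> qball d z \<rho>"
  have Wf: "W \<in> fmeasurable M" unfolding W_def using U(2)
    by (subst Int_commute) (intro fmeasurable_Int_fmeasurable, auto)
  have Wo: "qopen d W" unfolding W_def by (intro qopen_Int U qopen_qball)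
  have "\<exists>j. qball d x (s / 2 ^ j) \<subseteq> W \<and>
      measure M (A \<inter> qball d x (s / 2 ^ j)) < \<nu> * measure M (qball d x (s / 2 ^ j))" if x: "x \<in> N" for x
  proof -
    obtain J where J: "\<And>j. j \<ge> J \<Longrightarrow> measure M (A \<inter> qball d x (s / 2 ^ j))
      < \<nu> * measure M (qball d x (s / 2 ^ j))" using x by (auto simp: N_def)
    have "x \<in> W" using x A U by (auto simp: N_def W_def)
    then obtain t where t: "0 < t" "qball d x t \<subseteq> W" using Wo by (auto simp: qopen_def)
    obtain i :: nat where i: "s / t < 2 ^ i" using real_arch_pow[of 2 "s / t"] by auto
    have "(2::real) ^ i \<le> 2 ^ max i J" by (intro power_increasing) auto
    then have "s / t < 2 ^ max i J" using i by linarith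
    then have "s / 2 ^ max i J \<le> t" using t(1) by (simp add: field_simps)
    then have "qball d x (s / 2 ^ max i J) \<subseteq> W" using qball_mono t(2) by blast
    \<comment> \<open>The index \<open>i\<close> makes the ball fit into \<open>W\<close>, and
      \<open>J\<close> makes its density low.\<close>
    then show ?thesis using J[of "max i J"] by (intro exI[of _ "max i J"]) simp
  qed
  then obtain j where j: "\<And>x. x \<in> N \<Longrightarrow> qball d x (s / 2 ^ j x) \<subseteq> W"
    "\<And>x. x \<in> N \<Longrightarrow> measure M (A \<inter> qball d x (s / 2 ^ j x)) < \<nu> * measure M (qball d x (s / 2 ^ j x))"
    by metis
  obtain V where V: "V \<in> fmeasurable M" "N \<subseteq> V" "measure M V \<le> c * measure M (W - A)"
    using measure_cover_by_low_density_balls[OF s nu m Wf A(1) j] unfolding c_def by blast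
  have "W - A = (U - A) \<inter> qball d z \<rho>" by (auto simp: W_def)
  then have "c * measure M (W - A) < e" using small c by (simp add: field_simps)
  then show ?thesis using V by (intro bexI[of _ V]) auto
qed

text \<open>A stopping argument: outside a set with covers of arbitrarily small measure, halving the
  radius from \<open>s\<close> passes from density below \<open>\<nu>\<close> to density at least
  \<open>\<nu>\<close>. At the passage \<open>step\<close> puts the larger ball into
  \<open>W\<close>, and its low density allows the covering bound.\<close>

lemma measure_decay_step:
  assumes A: "A \<in> sets M" "A \<subseteq> W" and W: "W \<in> sets M" "W \<subseteq> qball d z \<rho>"
    and s: "0 < s" and nu: "\<nu> < 1" and m: "2 * K \<le> 2 ^ m"
    and start: "\<And>x. x \<in> A \<Longrightarrow> measure M (A \<inter> qball d x s) < \<nu> * measure M (qball d x s)"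
    and step: "\<And>x j. x \<in> A \<Longrightarrow>
      \<nu> * measure M (qball d x (s / 2 ^ Suc j)) \<le> measure M (A \<inter> qball d x (s / 2 ^ Suc j)) \<Longrightarrow>
      qball d x (s / 2 ^ j) \<subseteq> W"
  shows "measure M A \<le> C\<^sub>D ^ m / (1 - \<nu>) * measure M (W - A)"
proof (rule field_le_epsilon)
  fix e :: real assume e: "0 < e"
  define N where "N = {x\<in>A. \<exists>J::nat. \<forall>j\<ge>J. measure M (A \<inter> qball d x (s / 2 ^ j))
      < \<nu> * measure M (qball d x (s / 2 ^ j))}"
  have Wf: "W \<in> fmeasurable M" using W by (meson fmeasurableI2 qball_fmeasurable)
  have Az: "A \<subseteq> qball d z \<rho>" using A W by blast
  obtain V where V: "V \<in> fmeasurable M" "N \<subseteq> V" "measure M V < e"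
    using low_density_points_negligible[OF A(1) Az s nu e] unfolding N_def by blast
  have "\<exists>j. qball d x (s / 2 ^ j) \<subseteq> W \<and>
      measure M (A \<inter> qball d x (s / 2 ^ j)) < \<nu> * measure M (qball d x (s / 2 ^ j))"
    if x: "x \<in> A - N" for x
  proof -
    define P where "P j \<longleftrightarrow> \<nu> * measure M (qball d x (s / 2 ^ j)) \<le> measure M (A \<inter> qball d x (s / 2 ^ j))"
      for j :: nat
    \<comment> \<open>Off \<open>N\<close> the density is at least \<open>\<nu>\<close> for
      arbitrarily large \<open>j\<close>; as \<open>P 0\<close> fails, there is a first passage from
      failure to success.\<close>
    have ex: "\<exists>j. P j" using x unfolding N_def P_def by (auto simp: not_less)
    have "\<not> P 0" using start x by (auto simp: P_def not_le)
    then obtain i where i: "P (Suc i)" "\<not> P i"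
      using ex nat_induct[of "\<lambda>j. \<not> P j"] by blast
    then show ?thesis using step x by (intro exI[of _ i]) (auto simp: P_def not_le)
  qed
  then obtain j where j: "\<And>x. x \<in> A - N \<Longrightarrow> qball d x (s / 2 ^ j x) \<subseteq> W"
    "\<And>x. x \<in> A - N \<Longrightarrow> measure M (A \<inter> qball d x (s / 2 ^ j x)) < \<nu> * measure M (qball d x (s / 2 ^ j x))"
    by metis
  obtain V' where V': "V' \<in> fmeasurable M" "A - N \<subseteq> V'"
    "measure M V' \<le> C\<^sub>D ^ m / (1 - \<nu>) * measure M (W - A)"
    using measure_cover_by_low_density_balls[OF s nu m Wf A(1) j] by blast
  have "measure M A \<le> measure M (V' \<union> V)"
    using V V' A by (intro measure_mono_fmeasurable) auto
  also have "\<dots> \<le> measure M V' + measure M V" using V V' by (intro measure_Un_le) auto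
  also have "\<dots> \<le> C\<^sub>D ^ m / (1 - \<nu>) * measure M (W - A) + e" using V V' by linarith
  finally show "measure M A \<le> C\<^sub>D ^ m / (1 - \<nu>) * measure M (W - A) + e" .
qed

section \<open>Growth of the distance under small displacements\<close>

text \<open>The Hoelder exponents \<open>\<alpha>\<close> and \<open>1 - \<alpha>\<close> add up to
  one, so the bound scales like \<open>R\<close> and \<open>L\<close> depends only on the space. The
  ratio \<open>2 powr - \<alpha>\<close> makes the increments summable over dyadic scales.\<close>

lemma dist_increment:
  obtains L where "0 < L"
    "\<And>z x y R n. \<lbrakk>0 < R; d z x < R; d x y < 2 * K * R / 2 ^ n\<rbrakk> \<Longrightarrow>
       d z y \<le> d z x + L * (2 powr - \<alpha>) ^ n * R"
proof
  \<comment> \<open>The quasi triangle inequality bounds \<open>d z y + d z x\<close> by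
    \<open>D * R\<close>.\<close>
  define D where "D = 1 + K * (1 + 2 * K)"
  define L where "L = \<beta> * (2 * K) powr \<alpha> * D powr (1 - \<alpha>)"
  have D: "0 < D" using K_ge_1 by (simp add: D_def add_pos_nonneg)
  show "0 < L" using beta_pos K_ge_1 D by (simp add: L_def)
  fix z x y R n assume R: "0 < R" "d z x < R" "d x y < 2 * K * R / 2 ^ n"
  have "2 * K * R / 2 ^ n \<le> 2 * K * R" using R K_ge_1 by (simp add: divide_le_eq)
  then have "d z x + d x y \<le> R + 2 * K * R" using R by linarith
  then have "K * (d z x + d x y) \<le> K * (R + 2 * K * R)" using K_ge_1 by (intro mult_left_mono) auto
  then have "d z y \<le> K * (R + 2 * K * R)" using quasi_triangle[of z y x] by linarith
  then have "d z y + d z x \<le> K * (R + 2 * K * R) + R" using R by linarith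
  also have "\<dots> = D * R" by (simp add: D_def algebra_simps)
  finally have 1: "(d z y + d z x) powr (1 - \<alpha>) \<le> (D * R) powr (1 - \<alpha>)"
    using alpha_le_1 by (intro powr_mono2) auto
  have 2: "d y x powr \<alpha> \<le> (2 * K * R / 2 ^ n) powr \<alpha>"
    using R alpha_pos sym[of x y] by (intro powr_mono2) auto
  have "\<bar>d z y - d z x\<bar> \<le> \<beta> * d y x powr \<alpha> * (d z y + d z x) powr (1 - \<alpha>)" by (rule hoelder)
  also have "\<dots> \<le> \<beta> * (2 * K * R / 2 ^ n) powr \<alpha> * (D * R) powr (1 - \<alpha>)"
    using 1 2 beta_pos by (intro mult_mono) auto
  also have "(2 * K * R / 2 ^ n) powr \<alpha> = (2 * K) powr \<alpha> * R powr \<alpha> * (2 powr - \<alpha>) ^ n"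
  proof -
    have "(2 powr - \<alpha>) ^ n = 2 powr (- \<alpha> * real n)" by (simp add: powr_powr flip: powr_realpow)
    also have "\<dots> = 1 / (2 ^ n) powr \<alpha>"
      by (simp add: powr_powr powr_minus_divide mult.commute flip: powr_realpow)
    finally show ?thesis using R K_ge_1 by (simp add: powr_divide powr_mult)
  qed
  also have "(D * R) powr (1 - \<alpha>) = D powr (1 - \<alpha>) * R powr (1 - \<alpha>)"
    using R D by (simp add: powr_mult)
  also have "\<beta> * ((2 * K) powr \<alpha> * R powr \<alpha> * (2 powr - \<alpha>) ^ n) * (D powr (1 - \<alpha>) * R powr (1 - \<alpha>))
    = L * (2 powr - \<alpha>) ^ n * (R powr \<alpha> * R powr (1 - \<alpha>))" by (simp add: L_def)
  also have "R powr \<alpha> * R powr (1 - \<alpha>) = R" using R by (simp flip: powr_add)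
  finally show "d z y \<le> d z x + L * (2 powr - \<alpha>) ^ n * R" by linarith
qed

end

section \<open>Scaling, level sets and infima of partial functions\<close>

lemma dom_scale_pfun [simp]: "dom (scale_pfun l g) = dom g"
  by (auto simp: scale_pfun_def dom_def)

lemma the_scale_pfun: "x \<in> dom g \<Longrightarrow> the (scale_pfun l g x) = l * the (g x)"
  by (auto simp: scale_pfun_def)

lemma meas_pfun_scale:
  assumes "meas_pfun M g"
  shows "meas_pfun M (scale_pfun l g)"
proof -
  have "(\<lambda>x. l * the (g x)) \<in> borel_measurable (restrict_space M (dom g))"
    using assms unfolding meas_pfun_def by (intro borel_measurable_times) auto
  also have "?this \<longleftrightarrow> (\<lambda>x. the (scale_pfun l g x)) \<in> borel_measurable (restrict_space M (dom g))"
    by (intro measurable_cong) (auto simp: the_scale_pfun space_restrict_space)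
  finally show ?thesis by (simp add: meas_pfun_def)
qed

text \<open>\<open>dom u\<close> may be nonmeasurable: measurability of \<open>u\<close> only makes
  its level sets traces on \<open>dom u\<close> of measurable sets. Cutting with a measurable
  \<open>B\<close> inside \<open>dom u\<close> removes the trace.\<close>

lemma meas_pfun_level_set:
  assumes "meas_pfun M u" "B \<subseteq> dom u" "B \<in> sets M" "I \<in> sets borel"
  shows "{x\<in>B. the (u x) \<in> I} \<in> sets M"
proof -
  have "(\<lambda>x. the (u x)) -` I \<inter> space (restrict_space M (dom u)) \<in> sets (restrict_space M (dom u))"
    using assms unfolding meas_pfun_def by (intro measurable_sets)
  then obtain A where A: "A \<in> sets M"
    "(\<lambda>x. the (u x)) -` I \<inter> space (restrict_space M (dom u)) = dom u \<inter> A"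
    by (auto simp: sets_restrict_space)
  have "{x\<in>B. the (u x) \<in> I} = A \<inter> B"
    using assms(2) A(2) sets.sets_into_space[OF assms(3)] by (auto simp: space_restrict_space)
  then show ?thesis using A assms by auto
qed

lemma inf_on_greatest:
  "B \<noteq> {} \<Longrightarrow> (\<And>x. x \<in> B \<Longrightarrow> c \<le> the (u x)) \<Longrightarrow> c \<le> inf_on B u"
  unfolding inf_on_def by (rule cINF_greatest)

lemma inf_on_lower:
  assumes "c \<le> inf_on B u" "x \<in> B" "B \<subseteq> dom u" "\<forall>t\<in>ran u. 0 \<le> t"
  shows "c \<le> the (u x)"
proof -
  have "0 \<le> the (u y)" if y: "y \<in> B" for y
  proof -
    obtain t where "u y = Some t" using y assms(3) by blast
    then show ?thesis using assms(4) by (auto simp: ran_def)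
  qed
  then have "bdd_below ((\<lambda>x. the (u x)) ` B)" by (intro bdd_belowI[of _ 0]) auto
  then show ?thesis using cINF_lower[of "\<lambda>x. the (u x)" B x] assms(1,2)
    unfolding inf_on_def by auto
qed

text \<open>With the homogeneity of \<open>S\<close>, this turns smallness relative to level
  \<open>t\<close> for \<open>f\<close> into smallness below \<open>e\<close> for
  \<open>f / t\<close>.\<close>

lemma scaled_less_ennreal:
  assumes "0 < t" "a < ennreal (e * t)"
  shows "ennreal \<bar>1 / t\<bar> * a < ennreal e"
proof (cases a)
  case (real r)
  then have "r < e * t" using assms(2) by (simp add: ennreal_less_iff)
  then show ?thesis using real assms(1)
    by (simp add: ennreal_less_iff divide_less_eq flip: ennreal_mult)
qed (use assms in auto)

section \<open>From critical density to the double ball property\<close>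

context hoelder_space
begin

lemma S_function_mono:
  assumes S: "S_function d M \<Omega> S" and "f \<in> fin_funs d M \<Omega> S"
    and "0 < r" "qball d x r \<subseteq> qball d y s" "qball d y s \<subseteq> \<Omega>"
  shows "S (qball d x r) f \<le> S (qball d y s) f"
proof -
  have "0 < s" using assms(4) center_in_qball[OF assms(3), of x] qball_empty[of s y] by force
  then have "qball d x r \<in> balls_in d \<Omega>" "qball d y s \<in> balls_in d \<Omega>"
    using assms unfolding balls_in_def by blast+
  then show ?thesis using S assms unfolding S_function_def fin_funs_def by blast
qed

text \<open>The ball of radius \<open>R / 2\<close> fills at least the fraction \<open>1 / C\<^sub>D\<^sup>2\<close> of the ball of radius \<open>2 * R\<close>,
  so \<open>u \<ge> 1\<close> on the former lets the critical density property act on the latter.\<close>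

lemma double_ball_of_critical_density:
  assumes S: "S_function d M \<Omega> S" and families: "K_families d M \<Omega> S \<K>"
    and f: "f \<in> fin_funs d M \<Omega> S"
    and CD: "critical_density d M \<Omega> S \<K> f \<nu> c \<epsilon> \<eta>"
    and nu: "\<nu> < 1 / C\<^sub>D\<^sup>2" and eta: "1 < \<eta>"
  shows "double_ball d \<Omega> S \<K> f c \<epsilon> (2 * \<eta>)"
  unfolding double_ball_def
proof (intro allI ballI impI)
  fix z R u
  assume R: "0 < R" and u: "u \<in> \<K> f" and "qball d z (2 * \<eta> * R) \<subseteq> \<Omega>" "qball d z (2 * \<eta> * R) \<subseteq> dom u"
    and inf: "1 \<le> inf_on (qball d z (R / 2)) u" and "S (qball d z (2 * \<eta> * R)) f < ennreal \<epsilon>"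
  then have dom: "qball d z (\<eta> * (2 * R)) \<subseteq> \<Omega>" "qball d z (\<eta> * (2 * R)) \<subseteq> dom u"
    and small: "S (qball d z (\<eta> * (2 * R))) f < ennreal \<epsilon>" by (simp_all add: mult_ac)
  have u': "meas_pfun M u" "\<forall>t\<in>ran u. 0 \<le> t" using families f u unfolding K_families_def by blast+
  have "qball d z (2 * R) \<subseteq> qball d z (\<eta> * (2 * R))"
    using eta R by (intro qball_mono) simp
  then have sub: "qball d z (2 * R) \<subseteq> dom u" using dom by blast
  moreover have half: "qball d z (R / 2) \<subseteq> qball d z (2 * R)" using R by (intro qball_mono) simp
  ultimately have ge: "1 \<le> the (u x)" if "x \<in> qball d z (R / 2)" for x
    using inf_on_lower[OF inf that] u' by blast
  have "{x \<in> qball d z (2 * R). the (u x) \<in> {1..}} \<in> sets M"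
    using u' sub by (intro meas_pfun_level_set) auto
  then have lev: "{x \<in> qball d z (2 * R). 1 \<le> the (u x)} \<in> sets M" by simp
  have "measure M (qball d z (2 * R)) \<le> C\<^sub>D\<^sup>2 * measure M (qball d z (R / 2))"
    using measure_qball_power[of "R / 2" z 2] R by simp
  then have "measure M (qball d z (2 * R)) / C\<^sub>D\<^sup>2 \<le> measure M (qball d z (R / 2))"
    using doubling_constant_pos by (simp add: divide_le_eq mult.commute)
  moreover have "\<nu> * measure M (qball d z (2 * R)) \<le> 1 / C\<^sub>D\<^sup>2 * measure M (qball d z (2 * R))"
    using nu by (intro mult_right_mono) auto
  ultimately have "\<nu> * measure M (qball d z (2 * R)) \<le> measure M (qball d z (R / 2))" by simp
  also have "\<dots> \<le> measure M {x \<in> qball d z (2 * R). 1 \<le> the (u x)}"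
    using lev half ge by (intro measure_mono_fmeasurable fmeasurableI2[OF qball_fmeasurable[of z "2 * R"]]) auto
  \<comment> \<open>Critical density at radius \<open>2 * R\<close> concludes on the ball of half
    that radius, which is \<open>R\<close>.\<close>
  finally have "c \<le> inf_on (qball d z (2 * R / 2)) u \<or> ennreal \<epsilon> \<le> S (qball d z (\<eta> * (2 * R))) f"
    using R u dom by (intro CD[unfolded critical_density_def, rule_format]) auto
  then show "c \<le> inf_on (qball d z R) u" using small by auto
qed

text \<open>The double ball property derived from critical density has dilation
  \<open>2 * \<eta>\<close>; monotonicity of \<open>S\<close> lets both properties share it.\<close>

lemma critical_density_enlarge:
  assumes S: "S_function d M \<Omega> S" and f: "f \<in> fin_funs d M \<Omega> S"
    and CD: "critical_density d M \<Omega> S \<K> f \<nu> c \<epsilon> \<eta>" and eta: "0 < \<eta>" "\<eta> \<le> \<eta>'"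
  shows "critical_density d M \<Omega> S \<K> f \<nu> c \<epsilon> \<eta>'"
  unfolding critical_density_def
proof (intro allI ballI impI)
  fix z R u
  assume R: "0 < R" and u: "u \<in> \<K> f" and dom: "qball d z (\<eta>' * R) \<subseteq> \<Omega>" "qball d z (\<eta>' * R) \<subseteq> dom u"
    and dens: "\<nu> * measure M (qball d z R) \<le> measure M {x \<in> qball d z R. 1 \<le> the (u x)}"
  have sub: "qball d z (\<eta> * R) \<subseteq> qball d z (\<eta>' * R)" using eta R by (intro qball_mono) simp
  have "S (qball d z (\<eta> * R)) f \<le> S (qball d z (\<eta>' * R)) f"
    using eta R by (intro S_function_mono[OF S f _ sub dom(1)]) simp
  moreover have "c \<le> inf_on (qball d z (R / 2)) u \<or> ennreal \<epsilon> \<le> S (qball d z (\<eta> * R)) f"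
    using R u dens dom sub by (intro CD[unfolded critical_density_def, rule_format]) auto
  ultimately show "c \<le> inf_on (qball d z (R / 2)) u \<or> ennreal \<epsilon> \<le> S (qball d z (\<eta>' * R)) f"
    by (auto intro: order_trans)
qed

end

section \<open>Critical density and double ball at arbitrary levels\<close>

text \<open>The common setting for (A) and (B). Both properties are assumed for all \<open>f\<close>
  with the same constants, since rescaling \<open>u\<close> to \<open>u / t\<close> moves from the
  family of \<open>f\<close> to that of \<open>f / t\<close>.\<close>

locale critical_density_double_ball = hoelder_space d M C\<^sub>D K \<beta> \<alpha>
  for d :: "'a \<Rightarrow> 'a \<Rightarrow> real" and M :: "'a measure" and C\<^sub>D K \<beta> \<alpha> :: real +
  fixes \<Omega> :: "'a set" and S :: "'a set \<Rightarrow> ('a \<rightharpoonup> real) \<Rightarrow> ennreal"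
    and \<K> :: "('a \<rightharpoonup> real) \<Rightarrow> ('a \<rightharpoonup> real) set" and \<nu> c \<gamma> \<epsilon> \<eta> :: real
  assumes S: "S_function d M \<Omega> S" and families: "K_families d M \<Omega> S \<K>"
    and nu_less_1: "\<nu> < 1" and c_pos: "0 < c" and c_less_1: "c < 1"
    and gamma_pos: "0 < \<gamma>" and gamma_less_1: "\<gamma> < 1" and eps_pos: "0 < \<epsilon>" and eta_gt_1: "1 < \<eta>"
    and DB: "f \<in> fin_funs d M \<Omega> S \<Longrightarrow> double_ball d \<Omega> S \<K> f \<gamma> \<epsilon> \<eta>"
    and CD: "f \<in> fin_funs d M \<Omega> S \<Longrightarrow> critical_density d M \<Omega> S \<K> f \<nu> c \<epsilon> \<eta>"
begin

lemma S_scale: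
  assumes "f \<in> fin_funs d M \<Omega> S" "B \<in> balls_in d \<Omega>"
  shows "S B (scale_pfun l f) = ennreal \<bar>l\<bar> * S B f"
proof -
  have "f \<in> meas_funs M \<Omega>" using assms by (simp add: fin_funs_def)
  then show ?thesis
    using S[unfolded S_function_def, THEN conjunct2, rule_format, of f B l] assms(2) by blast
qed

lemma fin_funs_scale:
  assumes f: "f \<in> fin_funs d M \<Omega> S"
  shows "scale_pfun l f \<in> fin_funs d M \<Omega> S"
proof -
  have "S B (scale_pfun l f) < \<infinity>" if B: "B \<in> balls_in d \<Omega>" for B
  proof -
    have "S B f < \<infinity>" using f B by (simp add: fin_funs_def)
    then show ?thesis by (simp add: S_scale[OF f B] ennreal_mult_less_top)
  qed
  then show ?thesis using f by (simp add: fin_funs_def meas_funs_def meas_pfun_scale)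
qed

lemma family_scale:
  "f \<in> fin_funs d M \<Omega> S \<Longrightarrow> u \<in> \<K> f \<Longrightarrow> 0 \<le> l \<Longrightarrow> scale_pfun l u \<in> \<K> (scale_pfun l f)"
  using families unfolding K_families_def by blast

lemma family_measurable: "f \<in> fin_funs d M \<Omega> S \<Longrightarrow> u \<in> \<K> f \<Longrightarrow> meas_pfun M u"
  and family_nonneg: "f \<in> fin_funs d M \<Omega> S \<Longrightarrow> u \<in> \<K> f \<Longrightarrow> \<forall>t\<in>ran u. 0 \<le> t"
  using families unfolding K_families_def by blast+

text \<open>Critical density at level 1 is applied to \<open>u / t\<close>, which belongs to the
  family of \<open>f / t\<close>. The double ball property is rescaled in the same way next.\<close>

lemma critical_density_at_level:
  assumes f: "f \<in> fin_funs d M \<Omega> S" and u: "u \<in> \<K> f" and r: "0 < r" and t: "0 < t"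
    and dom: "qball d x (\<eta> * r) \<subseteq> \<Omega>" "qball d x (\<eta> * r) \<subseteq> dom u"
    and small: "S (qball d x (\<eta> * r)) f < ennreal (\<epsilon> * t)"
    and dens: "\<nu> * measure M (qball d x r) \<le> measure M {y\<in>qball d x r. t \<le> the (u y)}"
    and y: "y \<in> qball d x (r / 2)"
  shows "c * t \<le> the (u y)"
proof -
  define v where "v = scale_pfun (1 / t) u"
  define g where "g = scale_pfun (1 / t) f"
  have g: "g \<in> fin_funs d M \<Omega> S" unfolding g_def by (rule fin_funs_scale[OF f])
  have v: "v \<in> \<K> g" unfolding g_def v_def using f u t by (intro family_scale) auto
  have dv: "dom v = dom u" by (simp add: v_def)
  have sub: "qball d x r \<subseteq> qball d x (\<eta> * r)" "qball d x (r / 2) \<subseteq> qball d x (\<eta> * r)"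
    using r eta_gt_1 mult_right_mono[of 1 \<eta> r] by (auto intro!: qball_mono)
  have the_v: "the (v y) = the (u y) / t" if "y \<in> qball d x (\<eta> * r)" for y
    using that dom by (auto simp: v_def the_scale_pfun subset_iff)
  have "{y\<in>qball d x r. 1 \<le> the (v y)} = {y\<in>qball d x r. t \<le> the (u y)}"
    using sub(1) t the_v by (auto simp: le_divide_eq)
  moreover have "S (qball d x (\<eta> * r)) g < ennreal \<epsilon>"
  proof -
    have "0 < \<eta> * r" using r eta_gt_1 by simp
    then have "qball d x (\<eta> * r) \<in> balls_in d \<Omega>" using dom(1) unfolding balls_in_def by blast
    then show ?thesis unfolding g_def by (simp only: S_scale[OF f] scaled_less_ennreal[OF t small])
  qed
  ultimately have "c \<le> inf_on (qball d x (r / 2)) v"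
    using CD[OF g, unfolded critical_density_def, rule_format, of r v x] v r dom dens
    by (simp add: dv not_le[symmetric])
  then have "c \<le> the (v y)"
    using y family_nonneg[OF g v] sub dom
    by (intro inf_on_lower[of c "qball d x (r / 2)" v]) (auto simp: dv)
  then show ?thesis using the_v[of y] y sub(2) t by (auto simp: le_divide_eq)
qed

lemma double_ball_at_level:
  assumes f: "f \<in> fin_funs d M \<Omega> S" and u: "u \<in> \<K> f" and r: "0 < r" and t: "0 < t"
    and dom: "qball d x (\<eta> * r) \<subseteq> \<Omega>" "qball d x (\<eta> * r) \<subseteq> dom u"
    and small: "S (qball d x (\<eta> * r)) f < ennreal (\<epsilon> * t)"
    and half: "\<And>y. y \<in> qball d x (r / 2) \<Longrightarrow> t \<le> the (u y)"
    and y: "y \<in> qball d x r"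
  shows "\<gamma> * t \<le> the (u y)"
proof -
  define v where "v = scale_pfun (1 / t) u"
  define g where "g = scale_pfun (1 / t) f"
  have g: "g \<in> fin_funs d M \<Omega> S" unfolding g_def by (rule fin_funs_scale[OF f])
  have v: "v \<in> \<K> g" unfolding g_def v_def using f u t by (intro family_scale) auto
  have dv: "dom v = dom u" by (simp add: v_def)
  have sub: "qball d x r \<subseteq> qball d x (\<eta> * r)" "qball d x (r / 2) \<subseteq> qball d x (\<eta> * r)"
    using r eta_gt_1 mult_right_mono[of 1 \<eta> r] by (auto intro!: qball_mono)
  have the_v: "the (v y) = the (u y) / t" if "y \<in> qball d x (\<eta> * r)" for y
    using that dom by (auto simp: v_def the_scale_pfun subset_iff)
  have "1 \<le> inf_on (qball d x (r / 2)) v"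
    using center_in_qball[of "r / 2" x] r sub(2) t the_v half
    by (intro inf_on_greatest) (auto simp: le_divide_eq)
  moreover have "S (qball d x (\<eta> * r)) g < ennreal \<epsilon>"
  proof -
    have "0 < \<eta> * r" using r eta_gt_1 by simp
    then have "qball d x (\<eta> * r) \<in> balls_in d \<Omega>" using dom(1) unfolding balls_in_def by blast
    then show ?thesis unfolding g_def by (simp only: S_scale[OF f] scaled_less_ennreal[OF t small])
  qed
  ultimately have "\<gamma> \<le> inf_on (qball d x r) v"
    using DB[OF g, unfolded double_ball_def, rule_format, of r v x] v r dom by (simp add: dv)
  then have "\<gamma> \<le> the (v y)"
    using y family_nonneg[OF g v] sub dom
    by (intro inf_on_lower[of \<gamma> "qball d x r" v]) (auto simp: dv)
  then show ?thesis using the_v[of y] y sub(1) t by (auto simp: le_divide_eq)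
qed

text \<open>Critical density reaches only radius \<open>r / 2\<close>, so radius
  \<open>2 ^ i * r\<close> takes \<open>i + 1\<close> double ball steps, whence
  \<open>Suc i\<close>. The last step starts from level \<open>c * \<gamma> ^ i * t\<close> on the
  largest ball, so smallness of \<open>S\<close> there covers all earlier steps.\<close>

lemma critical_density_iterated:
  assumes f: "f \<in> fin_funs d M \<Omega> S" and u: "u \<in> \<K> f" and r: "0 < r" and t: "0 < t"
    and dom: "qball d x (\<eta> * (2 ^ i * r)) \<subseteq> \<Omega>" "qball d x (\<eta> * (2 ^ i * r)) \<subseteq> dom u"
    and small: "S (qball d x (\<eta> * (2 ^ i * r))) f < ennreal (\<epsilon> * (c * \<gamma> ^ i * t))"
    and dens: "\<nu> * measure M (qball d x r) \<le> measure M {y\<in>qball d x r. t \<le> the (u y)}"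
    and y: "y \<in> qball d x (2 ^ i * r)"
  shows "c * \<gamma> ^ Suc i * t \<le> the (u y)"
  using dom small y
proof (induction i arbitrary: y)
  case 0
  have "\<epsilon> * (c * t) \<le> \<epsilon> * t" using eps_pos c_less_1 t by (intro mult_left_mono) auto
  then have "S (qball d x (\<eta> * r)) f < ennreal (\<epsilon> * t)"
    using 0 by (auto intro: less_le_trans ennreal_leI)
  then have half: "c * t \<le> the (u y)" if "y \<in> qball d x (r / 2)" for y
    using critical_density_at_level[OF f u r t _ _ _ dens that] 0 by simp
  have "\<gamma> * (c * t) \<le> the (u y)"
    using 0 c_pos t by (intro double_ball_at_level[OF f u r _ _ _ _ half]) auto
  then show ?case by (simp add: mult_ac)
next
  case (Suc i)
  have sub: "qball d x (\<eta> * (2 ^ i * r)) \<subseteq> qball d x (\<eta> * (2 ^ Suc i * r))"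
    using eta_gt_1 r by (intro qball_mono) simp
  have "S (qball d x (\<eta> * (2 ^ i * r))) f \<le> S (qball d x (\<eta> * (2 ^ Suc i * r))) f"
    using eta_gt_1 r sub Suc.prems(1) by (intro S_function_mono[OF S f]) auto
  also have "\<dots> < ennreal (\<epsilon> * (c * \<gamma> ^ Suc i * t))" by (rule Suc.prems)
  finally have S1: "S (qball d x (\<eta> * (2 ^ i * r))) f < ennreal (\<epsilon> * (c * \<gamma> ^ Suc i * t))" .
  have "\<gamma> ^ Suc i \<le> \<gamma> ^ i" using gamma_pos gamma_less_1 by (intro power_decreasing) auto
  then have "\<epsilon> * (c * \<gamma> ^ Suc i * t) \<le> \<epsilon> * (c * \<gamma> ^ i * t)"
    using eps_pos c_pos t by (intro mult_left_mono mult_right_mono) auto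
  then have S2: "S (qball d x (\<eta> * (2 ^ i * r))) f < ennreal (\<epsilon> * (c * \<gamma> ^ i * t))"
    using S1 by (auto intro: less_le_trans ennreal_leI)
  have IH: "c * \<gamma> ^ Suc i * t \<le> the (u y)" if "y \<in> qball d x (2 ^ Suc i * r / 2)" for y
    using that sub Suc.prems S2 by (intro Suc.IH) auto
  have "\<gamma> * (c * \<gamma> ^ Suc i * t) \<le> the (u y)"
    using Suc.prems r t c_pos gamma_pos
    by (intro double_ball_at_level[OF f u _ _ _ _ _ IH, of "2 ^ Suc i * r" x y]) auto
  then show ?case by (simp add: mult_ac)
qed

end

section \<open>Decay of the level sets and power decay\<close>

context critical_density_double_ball
begin

text \<open>The constant \<open>b\<close> exceeds \<open>1 / \<gamma>\<close>, so that \<open>b\<^sup>k\<close> outweighs the loss \<open>\<gamma>\<^sup>k\<close> of \<open>k\<close> doublings; the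
  remaining factor pays for \<open>N + 2\<close> further ones.\<close>

lemma level_set_decay:
  assumes L: "\<And>z x y R n. \<lbrakk>0 < R; d z x < R; d x y < 2 * K * R / 2 ^ n\<rbrakk> \<Longrightarrow>
      d z y \<le> d z x + L * q ^ n * R"
    and L_nonneg: "0 \<le> L" and q: "0 < q" "q < 1" and N: "L * q ^ Suc N \<le> (1 - q) / 2"
    and m: "2 * K \<le> 2 ^ m"
    and f: "f \<in> fin_funs d M \<Omega> S" and u: "u \<in> \<K> f" and R: "0 < R"
    and dom: "qball d z (K * (1 + 2 * K * \<eta>) * R) \<subseteq> \<Omega>" "qball d z (K * (1 + 2 * K * \<eta>) * R) \<subseteq> dom u"
    and inf: "inf_on (qball d z R) u \<le> 1"
    and small: "S (qball d z (K * (1 + 2 * K * \<eta>) * R)) f < ennreal \<epsilon>"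
  defines "b \<equiv> 2 / (c * \<gamma> ^ (N + 2))"
  defines "E \<equiv> \<lambda>k. {x \<in> qball d z (R / 2 * (1 + q ^ k)). b ^ k < the (u x)}"
  shows "measure M (E (Suc k)) \<le> C\<^sub>D ^ m / (1 - \<nu>) * measure M (E k - E (Suc k))"
proof -
  let ?B = "qball d z (K * (1 + 2 * K * \<eta>) * R)"
  \<comment> \<open>The radii fall from \<open>R\<close> towards \<open>R / 2\<close>; the gap
    \<open>\<rho> k - \<rho> (Suc k) = q ^ k * ((1 - q) / 2) * R\<close> is the room for balls that
    stick out.\<close>
  define \<rho> where "\<rho> j = R / 2 * (1 + q ^ j)" for j :: nat
  have rho_le: "\<rho> j \<le> R" for j
    using R q power_le_one[of q j] by (simp add: \<rho>_def)
  have rho_dec: "\<rho> (Suc j) \<le> \<rho> j" for j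
    using R q by (simp add: \<rho>_def)
  have E_eq: "E j = {x \<in> qball d z (\<rho> j). b ^ j < the (u x)}" for j by (simp add: E_def \<rho>_def)
  have gam: "\<gamma> ^ i \<le> 1" "0 < \<gamma> ^ i" for i
    using gamma_pos gamma_less_1 by (simp_all add: power_le_one)
  \<comment> \<open>The value 2 leaves room for strict inequalities: against the infimum bound 1,
    and between \<open>2 * b ^ k\<close> and \<open>b ^ k\<close>.\<close>
  have bcg: "b * (c * \<gamma> ^ (N + 2)) = 2" using c_pos gamma_pos by (simp add: b_def)
  have b_pos: "0 < b" using c_pos gamma_pos by (simp add: b_def)
  have b_bound: "2 \<le> b * (c * \<gamma> ^ i)" if "i \<le> N + 2" for i
  proof -
    have "\<gamma> ^ (N + 2) \<le> \<gamma> ^ i" using that gamma_pos gamma_less_1 by (intro power_decreasing) auto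
    then have "b * (c * \<gamma> ^ (N + 2)) \<le> b * (c * \<gamma> ^ i)" using b_pos c_pos by simp
    then show ?thesis by (simp only: bcg)
  qed
  have b_gamma: "1 \<le> b * \<gamma>"
  proof -
    have "b * (c * \<gamma> ^ 1) \<le> b * (1 * \<gamma> ^ 1)"
      using b_pos gamma_pos c_less_1 by (intro mult_left_mono mult_right_mono) auto
    then show ?thesis using b_bound[of 1] by simp
  qed
  have b_gt_1: "1 < b"
    using b_gamma mult_strict_left_mono[OF gamma_less_1 b_pos] by simp
  have KR: "R \<le> 2 * K * R" using R K_ge_1 by simp
  \<comment> \<open>The dilation \<open>K * (1 + 2 * K * \<eta>)\<close> is chosen to contain all
    balls to which the two properties are applied.\<close>
  have ball_dom: "qball d x (\<eta> * (2 * K * R)) \<subseteq> ?B" if x: "x \<in> qball d z R" for x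
  proof
    fix y assume "y \<in> qball d x (\<eta> * (2 * K * R))"
    then have "d z x + d x y < R + \<eta> * (2 * K * R)" using x by (simp add: qball_def)
    then have "K * (d z x + d x y) < K * (R + \<eta> * (2 * K * R))"
      using K_ge_1 by (intro mult_strict_left_mono) auto
    then show "y \<in> ?B" using quasi_triangle[of z y x] by (simp add: qball_def algebra_simps)
  qed
  have "1 \<le> K * (1 + 2 * K * \<eta>)"
    using K_ge_1 eta_gt_1 mult_mono[of 1 K 1 "1 + 2 * K * \<eta>"] by simp
  then have RB: "qball d z R \<subseteq> ?B" using R by (intro qball_mono) simp
  \<comment> \<open>Once the level \<open>c * \<gamma> ^ i * t\<close> is at least 1, the hypothesis
    \<open>S < \<epsilon>\<close> on the large ball is small enough for every step.\<close>
  have spread: "c * \<gamma> ^ Suc i * t \<le> the (u y)"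
    if x: "x \<in> qball d z R" and r: "0 < r" "2 ^ i * r \<le> 2 * K * R" and t: "1 \<le> c * \<gamma> ^ i * t"
      and dens: "\<nu> * measure M (qball d x r) \<le> measure M {y\<in>qball d x r. t \<le> the (u y)}"
      and y: "y \<in> qball d x (2 ^ i * r)" for x r i t y
  proof (rule critical_density_iterated[OF f u r(1) _ _ _ _ dens y])
    show "0 < t" using t c_pos gam(2)[of i]
      by (metis less_le_trans mult_pos_pos zero_less_mult_pos zero_less_one)
    have "qball d x (\<eta> * (2 ^ i * r)) \<subseteq> qball d x (\<eta> * (2 * K * R))"
      using r eta_gt_1 by (intro qball_mono) simp
    then have sub: "qball d x (\<eta> * (2 ^ i * r)) \<subseteq> ?B" using ball_dom[OF x] by blast
    then show "qball d x (\<eta> * (2 ^ i * r)) \<subseteq> \<Omega>" "qball d x (\<eta> * (2 ^ i * r)) \<subseteq> dom u"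
      using dom by blast+
    have "S (qball d x (\<eta> * (2 ^ i * r))) f \<le> S ?B f"
      using r eta_gt_1 by (intro S_function_mono[OF S f _ sub dom(1)]) simp
    also note small
    also have "\<epsilon> \<le> \<epsilon> * (c * \<gamma> ^ i * t)" using t eps_pos by simp
    finally show "S (qball d x (\<eta> * (2 ^ i * r))) f < ennreal (\<epsilon> * (c * \<gamma> ^ i * t))"
      by (simp add: ennreal_leI)
  qed
  have E_sets: "E j \<in> sets M" for j
  proof -
    have "qball d z (\<rho> j) \<subseteq> dom u" using qball_mono[OF rho_le] RB dom by blast
    then have "{x\<in>qball d z (\<rho> j). the (u x) \<in> {b ^ j<..}} \<in> sets M"
      by (intro meas_pfun_level_set[OF family_measurable[OF f u]]) auto
    then show ?thesis by (simp add: E_eq)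
  qed
  have in_R: "x \<in> qball d z R" if "x \<in> E j" for x j using that qball_mono[OF rho_le] by (auto simp: E_eq)
  \<comment> \<open>After \<open>Suc k + N\<close> doublings \<open>s\<close> becomes
    \<open>2 * K * R\<close>, a radius for which balls centred in \<open>qball d z R\<close> contain
    that ball; yet \<open>s\<close> is small enough for the displacements to fit into the
    gap.\<close>
  define s where "s = 2 * K * R / 2 ^ (Suc k + N)"
  have s: "0 < s" using K_ge_1 R by (simp add: s_def)
  define t where "t = b ^ Suc k"
  have dens_sub: "\<nu> * measure M (qball d x r) \<le> measure M {y\<in>qball d x r. t \<le> the (u y)}"
    if "\<nu> * measure M (qball d x r) \<le> measure M (E (Suc k) \<inter> qball d x r)"
      and x: "x \<in> qball d z R" and r: "0 < r" "r \<le> 2 * K * R" for x r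
  proof -
    have "qball d x r \<subseteq> qball d x (\<eta> * (2 * K * R))"
      using r eta_gt_1 mult_right_mono[of 1 \<eta> "2 * K * R"] by (intro qball_mono) auto
    then have "qball d x r \<subseteq> dom u" using ball_dom[OF x] dom by blast
    then have "{y\<in>qball d x r. the (u y) \<in> {t..}} \<in> sets M"
      by (intro meas_pfun_level_set[OF family_measurable[OF f u]]) auto
    then have lev: "{y\<in>qball d x r. t \<le> the (u y)} \<in> sets M" by simp
    have "measure M (E (Suc k) \<inter> qball d x r) \<le> measure M {y\<in>qball d x r. t \<le> the (u y)}"
    proof (rule measure_mono_fmeasurable)
      show "E (Suc k) \<inter> qball d x r \<subseteq> {y\<in>qball d x r. t \<le> the (u y)}" by (auto simp: E_eq t_def)
      show "{y\<in>qball d x r. t \<le> the (u y)} \<in> fmeasurable M"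
        using lev by (intro fmeasurableI2[OF qball_fmeasurable[of x r]]) auto
    qed (use E_sets in auto)
    then show ?thesis using that(1) by linarith
  qed
  show ?thesis
  proof (rule measure_decay_step[OF E_sets _ E_sets _ s nu_less_1 m])
    show "E (Suc k) \<subseteq> E k"
    proof
      fix x assume x: "x \<in> E (Suc k)"
      have "b ^ k \<le> b ^ Suc k" using b_gt_1 by (intro power_increasing) auto
      then show "x \<in> E k" using x rho_dec[of k] by (auto simp: E_eq qball_def)
    qed
    show "E k \<subseteq> qball d z R" using in_R by blast
  next
    fix x assume xE: "x \<in> E (Suc k)"
    then have x: "x \<in> qball d z R" by (rule in_R)
    show "measure M (E (Suc k) \<inter> qball d x s) < \<nu> * measure M (qball d x s)"
    proof (rule ccontr)
      assume "\<not> ?thesis"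
      then have dens: "\<nu> * measure M (qball d x s) \<le> measure M (E (Suc k) \<inter> qball d x s)" by simp
      have 2: "2 ^ (Suc k + N) * s = 2 * K * R" by (simp add: s_def)
      have "(1::real) \<le> 2 ^ (Suc k + N)" by (rule one_le_power) simp
      from mult_right_mono[OF this, of s] s have "s \<le> 2 ^ (Suc k + N) * s" by simp
      then have sR: "s \<le> 2 * K * R" by (simp only: 2)
      \<comment> \<open>This is the level left after spreading from \<open>s\<close> to
        \<open>2 * K * R\<close>: each of \<open>k\<close> factors \<open>b\<close> pays for one
        \<open>\<gamma>\<close>, and the last \<open>b\<close> pays for \<open>c\<close> and the
        other \<open>N + 2\<close>. It puts \<open>u\<close> above 1 on all of
        \<open>qball d z R\<close>, contrary to \<open>inf\<close>.\<close>
      have big: "2 \<le> c * \<gamma> ^ Suc (Suc k + N) * t"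
      proof -
        have "c * \<gamma> ^ Suc (Suc k + N) * t = (b * \<gamma>) ^ k * (b * (c * \<gamma> ^ (N + 2)))"
          by (simp add: t_def power_mult_distrib power_add mult_ac)
        also have "\<dots> \<ge> 1 * (b * (c * \<gamma> ^ (N + 2)))"
          using b_gamma b_pos c_pos gamma_pos by (intro mult_right_mono one_le_power) auto
        finally show ?thesis by (simp only: bcg mult_1)
      qed
      have "\<gamma> ^ Suc (Suc k + N) \<le> \<gamma> ^ (Suc k + N)"
        using gamma_pos gamma_less_1 by (intro power_decreasing) auto
      then have "c * \<gamma> ^ Suc (Suc k + N) * t \<le> c * \<gamma> ^ (Suc k + N) * t"
        using c_pos b_pos by (intro mult_left_mono mult_right_mono) (auto simp: t_def)
      then have t1: "1 \<le> c * \<gamma> ^ (Suc k + N) * t" using big by linarith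
      have "2 \<le> the (u y)" if y: "y \<in> qball d z R" for y
      proof -
        have "d x z + d z y < R + R" using x y sym[of x z] by (simp add: qball_def)
        then have "K * (d x z + d z y) < K * (R + R)" using K_ge_1 by (intro mult_strict_left_mono) auto
        then have "y \<in> qball d x (2 ^ (Suc k + N) * s)"
          unfolding 2 using quasi_triangle[of x y z] by (simp add: qball_def)
        from spread[OF x s _ t1 dens_sub[OF dens x s sR] this]
        show ?thesis using big 2 by linarith
      qed
      then have "2 \<le> inf_on (qball d z R) u"
        using center_in_qball[OF R, of z] by (intro inf_on_greatest) auto
      then show False using inf by simp
    qed
  next
    fix x j assume xE: "x \<in> E (Suc k)"
    then have x: "x \<in> qball d z R" by (rule in_R)
    let ?r = "s / 2 ^ Suc j"
    assume dens: "\<nu> * measure M (qball d x ?r) \<le> measure M (E (Suc k) \<inter> qball d x ?r)"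
    have r: "0 < ?r" using s by simp
    have sj: "2 ^ 1 * ?r = s / 2 ^ j" by simp
    have s_eq: "s / 2 ^ j = 2 * K * R / 2 ^ (Suc k + N + j)" by (simp add: s_def power_add)
    have "(1::real) \<le> 2 ^ (Suc k + N + j)" by (rule one_le_power) simp
    then have "2 * K * R / 2 ^ (Suc k + N + j) \<le> 2 * K * R / 1"
      using K_ge_1 R by (intro divide_left_mono) auto
    then have r1: "2 ^ 1 * ?r \<le> 2 * K * R" unfolding sj s_eq by simp
    have "a \<le> 2 ^ 1 * a" if "0 < a" for a :: real using that by simp
    then have r2: "?r \<le> 2 * K * R" using r r1 order_trans by blast
    have bk: "1 \<le> b ^ k" using b_gt_1 by (simp add: one_le_power)
    have tk: "c * \<gamma> ^ i * t = b ^ k * (b * (c * \<gamma> ^ i))" for i by (simp add: t_def)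
    \<comment> \<open>Here \<open>i = 1\<close>: the spread goes from radius
      \<open>s / 2 ^ Suc j\<close> to \<open>s / 2 ^ j\<close> and loses
      \<open>c * \<gamma> ^ 2\<close>, less than one factor \<open>b\<close>.\<close>
    have "1 * 2 \<le> c * \<gamma> ^ 1 * t" unfolding tk using bk b_bound[of 1] by (intro mult_mono) auto
    then have t1: "1 \<le> c * \<gamma> ^ 1 * t" by simp
    have "b ^ k * 2 \<le> c * \<gamma> ^ Suc 1 * t" unfolding tk using bk b_bound[of 2] by (intro mult_left_mono) (auto simp: numeral_2_eq_2)
    then have t2: "b ^ k < c * \<gamma> ^ Suc 1 * t" using bk by linarith
    show "qball d x (s / 2 ^ j) \<subseteq> E k"
    proof
      fix y assume y: "y \<in> qball d x (s / 2 ^ j)"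
      then have "y \<in> qball d x (2 ^ 1 * ?r)" by simp
      from spread[OF x r r1 t1 dens_sub[OF dens x r r2] this]
      have uy: "b ^ k < the (u y)" using t2 by linarith
      \<comment> \<open>By the choice of \<open>N\<close> the displacement fits into the gap between
        \<open>\<rho> (Suc k)\<close> and \<open>\<rho> k\<close>.\<close>
      have "d z y \<le> d z x + L * q ^ (Suc k + N + j) * R"
        using x y R by (intro L) (auto simp: qball_def s_eq)
      also have "d z x < \<rho> (Suc k)" using xE by (simp add: E_eq qball_def)
      also have "L * q ^ (Suc k + N + j) * R \<le> L * q ^ (Suc k + N) * R"
        using L_nonneg q R by (intro mult_right_mono mult_left_mono power_decreasing) auto
      also have "\<dots> = q ^ k * (L * q ^ Suc N) * R" by (simp add: power_add)
      also have "\<dots> \<le> q ^ k * ((1 - q) / 2) * R" using N q R by (intro mult_right_mono mult_left_mono) auto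
      also have "\<rho> (Suc k) + \<dots> = \<rho> k" by (simp add: \<rho>_def field_simps)
      finally have "d z y < \<rho> k" by simp
      then show "y \<in> E k" using uy by (simp add: E_eq qball_def)
    qed
  qed
qed

text \<open>The level sets decay like \<open>\<theta> ^ n\<close> relative to the ball of radius
  \<open>R\<close>; passing to radius \<open>R / 2\<close> costs a factor \<open>C\<^sub>D\<close>.
  Power decay admits no such factor, so \<open>l\<close> levels are merged until
  \<open>\<theta> ^ l * C\<^sub>D < 1\<close>. For \<open>k \<ge> 1\<close> the factor is absorbed
  by \<open>C\<^sub>D \<le> C\<^sub>D ^ k\<close>, and \<open>k = 0\<close> is trivial.\<close>

lemma power_decay_uniform:
  "\<exists>\<gamma>\<^sub>P C \<eta>\<^sub>P. 0 < \<gamma>\<^sub>P \<and> \<gamma>\<^sub>P < 1 \<and> 1 < C \<and> 1 < \<eta>\<^sub>P \<and>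
     (\<forall>f\<in>fin_funs d M \<Omega> S. power_decay d M \<Omega> S \<K> f C \<gamma>\<^sub>P \<epsilon> \<eta>\<^sub>P)"
proof -
  define q where "q = 2 powr - \<alpha>"
  have "2 powr - \<alpha> < 2 powr (0::real)" using alpha_pos by (intro powr_less_mono) auto
  then have q: "0 < q" "q < 1" by (auto simp: q_def)
  obtain L where L: "0 < L" "\<And>z x y R n. \<lbrakk>0 < R; d z x < R; d x y < 2 * K * R / 2 ^ n\<rbrakk> \<Longrightarrow>
      d z y \<le> d z x + L * q ^ n * R"
    using dist_increment unfolding q_def by blast
  obtain N0 where "q ^ N0 < (1 - q) / 2 / L"
    using real_arch_pow_inv[of "(1 - q) / 2 / L" q] q L(1) by auto
  then have "L * q ^ N0 < (1 - q) / 2" using L(1) by (simp add: field_simps)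
  moreover have "L * q ^ Suc N0 \<le> L * q ^ N0"
    using q L(1) by (intro mult_left_mono power_decreasing) auto
  ultimately have N: "L * q ^ Suc N0 \<le> (1 - q) / 2" by linarith
  obtain m :: nat where m: "2 * K \<le> 2 ^ m" using real_arch_pow[of 2 "2 * K"] by (auto intro: less_imp_le)
  define b where "b = 2 / (c * \<gamma> ^ (N0 + 2))"
  have cg: "0 < c * \<gamma> ^ (N0 + 2)" using c_pos gamma_pos by simp
  have "c * \<gamma> ^ (N0 + 2) \<le> 1"
    using c_less_1 c_pos gamma_pos gamma_less_1 by (intro mult_le_one power_le_one) auto
  then have b: "1 < b" using cg by (simp add: b_def less_divide_eq)
  define Q where "Q = C\<^sub>D ^ m / (1 - \<nu>)"
  have Q: "0 < Q" using nu_less_1 doubling_constant_pos by (simp add: Q_def)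
  \<comment> \<open>Solving \<open>a' \<le> Q * (a - a')\<close> for \<open>a'\<close> gives
    \<open>a' \<le> \<theta> * a\<close>.\<close>
  define \<theta> where "\<theta> = Q / (1 + Q)"
  have theta: "0 < \<theta>" "\<theta> < 1" using Q by (auto simp: \<theta>_def)
  obtain l where "\<theta> ^ l < 1 / C\<^sub>D"
    using real_arch_pow_inv[of "1 / C\<^sub>D" \<theta>] theta doubling_constant_pos by auto
  then have l: "\<theta> ^ l * C\<^sub>D < 1" using doubling_constant_pos by (simp add: field_simps)
  \<comment> \<open>Since \<open>C\<^sub>D \<ge> 1\<close>, the exponent is nonzero, which gives
    \<open>1 < b ^ l\<close>.\<close>
  then have l0: "l \<noteq> 0" using doubling_constant_ge_1 by (intro notI) simp
  define \<eta>\<^sub>P where "\<eta>\<^sub>P = K * (1 + 2 * K * \<eta>)"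
  have "1 * 1 \<le> K * \<eta>" using K_ge_1 eta_gt_1 by (intro mult_mono) auto
  then have "1 < 1 + 2 * K * \<eta>" by simp
  then have eta: "1 < \<eta>\<^sub>P" unfolding \<eta>\<^sub>P_def using K_ge_1 by (smt (verit) mult_le_cancel_right1)
  have "power_decay d M \<Omega> S \<K> f (b ^ l) (\<theta> ^ l * C\<^sub>D) \<epsilon> \<eta>\<^sub>P" if f: "f \<in> fin_funs d M \<Omega> S" for f
    unfolding power_decay_def
  proof (intro allI ballI impI)
    fix z R u and k :: nat
    assume R: "0 < R" and u: "u \<in> \<K> f" and dom: "qball d z (\<eta>\<^sub>P * R) \<subseteq> \<Omega>" "qball d z (\<eta>\<^sub>P * R) \<subseteq> dom u"
      and inf: "inf_on (qball d z R) u \<le> 1" and small: "S (qball d z (\<eta>\<^sub>P * R)) f < ennreal \<epsilon>"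
    define E where "E k = {x \<in> qball d z (R / 2 * (1 + q ^ k)). b ^ k < the (u x)}" for k
    have step: "measure M (E (Suc k)) \<le> Q * measure M (E k - E (Suc k))" for k
      using level_set_decay[OF L(2) less_imp_le[OF L(1)] q N m f u R _ _ inf, of k] dom small
      unfolding E_def b_def Q_def \<eta>\<^sub>P_def by blast
    have sub: "qball d z (R / 2 * (1 + q ^ k)) \<subseteq> qball d z R" for k
      using R q power_le_one[of q k] by (intro qball_mono) simp
    have "R \<le> \<eta>\<^sub>P * R" using eta R by simp
    then have "qball d z R \<subseteq> dom u" using qball_mono dom by blast
    then have "{x \<in> qball d z (R / 2 * (1 + q ^ k)). the (u x) \<in> {b ^ k<..}} \<in> sets M" for k
      using sub[of k] by (intro meas_pfun_level_set[OF family_measurable[OF f u]]) auto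
    then have E_sets: "E k \<in> sets M" for k by (simp add: E_def)
    have E_fm: "E k \<in> fmeasurable M" for k
      using sub[of k] E_sets by (intro fmeasurableI2[OF qball_fmeasurable[of z R]]) (auto simp: E_def)
    have E_sub: "E (Suc k) \<subseteq> E k" for k
    proof -
      have "b ^ k \<le> b ^ Suc k" using b by (intro power_increasing) auto
      moreover have "R / 2 * (1 + q ^ Suc k) \<le> R / 2 * (1 + q ^ k)" using q R by simp
      ultimately show ?thesis by (auto simp: E_def qball_def)
    qed
    have decay: "measure M (E (Suc k)) \<le> \<theta> * measure M (E k)" for k
    proof -
      have "measure M (E k - E (Suc k)) = measure M (E k) - measure M (E (Suc k))"
        by (intro measurable_measure_Diff E_fm E_sets E_sub)
      then have "measure M (E (Suc k)) \<le> Q * (measure M (E k) - measure M (E (Suc k)))"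
        using step[of k] by simp
      then have "(1 + Q) * measure M (E (Suc k)) \<le> Q * measure M (E k)"
        by (simp add: algebra_simps)
      then show ?thesis using Q by (simp add: \<theta>_def field_simps)
    qed
    have E_le: "measure M (E n) \<le> \<theta> ^ n * measure M (qball d z R)" for n
    proof (induction n)
      case 0
      have "E 0 \<subseteq> qball d z R" using sub[of 0] by (auto simp: E_def)
      then have "measure M (E 0) \<le> measure M (qball d z R)"
        using E_sets[of 0] by (intro measure_mono_fmeasurable) auto
      then show ?case by simp
    next
      case (Suc n)
      have "\<theta> * measure M (E n) \<le> \<theta> * (\<theta> ^ n * measure M (qball d z R))"
        using Suc theta by (intro mult_left_mono) auto
      then show ?case using decay[of n] by (simp add: mult.assoc)
    qed
    let ?A = "{x \<in> qball d z (R / 2). (b ^ l) ^ k < the (u x)}"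
    show "measure M ?A \<le> (\<theta> ^ l * C\<^sub>D) ^ k * measure M (qball d z (R / 2))"
    proof (cases "k = 0")
      case True
      have "{x \<in> qball d z (R / 2). the (u x) \<in> {1<..}} \<in> sets M"
        using \<open>qball d z R \<subseteq> dom u\<close> qball_mono[of "R / 2" R z] R
        by (intro meas_pfun_level_set[OF family_measurable[OF f u]]) auto
      then show ?thesis using True by (auto intro!: measure_mono_fmeasurable)
    next
      case False
      have "R / 2 \<le> R / 2 * (1 + q ^ (l * k))" using R q by simp
      then have "qball d z (R / 2) \<subseteq> qball d z (R / 2 * (1 + q ^ (l * k)))" by (rule qball_mono)
      then have "?A \<subseteq> E (l * k)" unfolding E_def power_mult[of b l k] by blast
      moreover have "{x \<in> qball d z (R / 2). the (u x) \<in> {(b ^ l) ^ k<..}} \<in> sets M"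
        using \<open>qball d z R \<subseteq> dom u\<close> qball_mono[of "R / 2" R z] R
        by (intro meas_pfun_level_set[OF family_measurable[OF f u]]) auto
      ultimately have "measure M ?A \<le> measure M (E (l * k))"
        using E_fm by (intro measure_mono_fmeasurable) auto
      also have "\<dots> \<le> \<theta> ^ (l * k) * measure M (qball d z (2 * (R / 2)))" using E_le[of "l * k"] by simp
      also have "\<dots> \<le> \<theta> ^ (l * k) * (C\<^sub>D * measure M (qball d z (R / 2)))"
        using theta R by (intro mult_left_mono measure_qball_double) auto
      also have "C\<^sub>D * measure M (qball d z (R / 2)) \<le> C\<^sub>D ^ k * measure M (qball d z (R / 2))"
        using False doubling_constant_ge_1 by (intro mult_right_mono self_le_power) auto
      finally show ?thesis using theta by (simp add: power_mult power_mult_distrib mult.assoc)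
    qed
  qed
  moreover have "0 < \<theta> ^ l * C\<^sub>D" using theta doubling_constant_pos by simp
  moreover have "1 < b ^ l" using b l0 by (simp add: one_less_power)
  ultimately show ?thesis using l eta
    by (intro exI[of _ "\<theta> ^ l * C\<^sub>D"] exI[of _ "b ^ l"] exI[of _ \<eta>\<^sub>P] conjI ballI)
qed

end

section \<open>Reduction of both cases to the common setting\<close>

theorem theorem2p7:
  fixes d :: "'a \<Rightarrow> 'a \<Rightarrow> real" and M :: "'a measure" and C\<^sub>D \<delta> :: real
    and \<Omega> :: "'a set"
    and S :: "'a set \<Rightarrow> ('a \<rightharpoonup> real) \<Rightarrow> ennreal"
    and \<K> :: "('a \<rightharpoonup> real) \<Rightarrow> ('a \<rightharpoonup> real) set"
  assumes space: "hoelder_doubling_space d M C\<^sub>D"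
    and regular: "ball_regular d M"
    and Omega: "qopen d \<Omega>"
    and S: "S_function d M \<Omega> S"
    and K: "K_families d M \<Omega> S \<K>"
    and delta: "0 < \<delta>" "\<delta> < 1"
    and reverse_doubling:
      "\<And>x r. 0 < r \<Longrightarrow> qball d x (2 * r) \<subseteq> \<Omega> \<Longrightarrow>
         measure M (qball d x r) \<le> \<delta> * measure M (qball d x (2 * r))"
    and A_or_B:
      "((\<exists>\<nu> c \<gamma> \<epsilon> \<eta>.
           0 < \<nu> \<and> \<nu> < 1 \<and> 0 < c \<and> c < 1 \<and> 0 < \<gamma> \<and> \<gamma> < 1 \<and> 0 < \<epsilon> \<and> \<epsilon> < 1 \<and> 1 < \<eta> \<and>
           (\<forall>f\<in>fin_funs d M \<Omega> S.
              double_ball d \<Omega> S \<K> f \<gamma> \<epsilon> \<eta> \<and> critical_density d M \<Omega> S \<K> f \<nu> c \<epsilon> \<eta>)) \<and>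
        (\<exists>\<omega>. ring_condition d M \<omega> \<and>
             \<omega> \<in> o[at_right 0](\<lambda>s. 1 / (ln (1 / s))\<^sup>2)))
       \<or>
       ((\<exists>\<nu> c \<epsilon> \<eta>.
           0 < \<nu> \<and> \<nu> < 1 / C\<^sub>D\<^sup>2 \<and> 0 < c \<and> c < 1 \<and> 0 < \<epsilon> \<and> \<epsilon> < 1 \<and> 1 < \<eta> \<and>
           (\<forall>f\<in>fin_funs d M \<Omega> S. critical_density d M \<Omega> S \<K> f \<nu> c \<epsilon> \<eta>)) \<and>
        (\<forall>x. continuous_on {0<..} (\<lambda>r. measure M (qball d x r))))"
  shows "\<exists>\<gamma>\<^sub>P \<epsilon>\<^sub>P C \<eta>\<^sub>P.
           0 < \<gamma>\<^sub>P \<and> \<gamma>\<^sub>P < 1 \<and> 0 < \<epsilon>\<^sub>P \<and> \<epsilon>\<^sub>P < 1 \<and> 1 < C \<and> 1 < \<eta>\<^sub>P \<and>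
           (\<forall>f\<in>fin_funs d M \<Omega> S. power_decay d M \<Omega> S \<K> f C \<gamma>\<^sub>P \<epsilon>\<^sub>P \<eta>\<^sub>P)"
proof -
  have qd: "quasi_distance d" and hc: "hoelder_continuous d"
    using space by (simp_all only: hoelder_doubling_space_def)
  from qd have "(\<forall>x y. 0 \<le> d x y) \<and> (\<forall>x y. d x y = d y x) \<and> (\<forall>x y. d x y = 0 \<longleftrightarrow> x = y) \<and>
      (\<exists>K\<ge>1. \<forall>x y z. d x y \<le> K * (d x z + d z y))"
    unfolding quasi_distance_def .
  then obtain K where K1: "1 \<le> K" and "\<forall>x y z. d x y \<le> K * (d x z + d z y)"
    and "\<forall>x y. 0 \<le> d x y" "\<forall>x y. d x y = d y x" "\<forall>x y. d x y = 0 \<longleftrightarrow> x = y"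
    by (elim exE conjE)
  note dist = this(2-)[rule_format]
  obtain \<beta> \<alpha> where "0 < \<beta>" "0 < \<alpha>" "\<alpha> \<le> 1"
    "\<forall>x y z. \<bar>d x y - d x z\<bar> \<le> \<beta> * d y z powr \<alpha> * (d x y + d x z) powr (1 - \<alpha>)"
    using hc unfolding hoelder_continuous_def by (elim exE conjE)
  note hol = this[rule_format]
  interpret hoelder_space d M C\<^sub>D K \<beta> \<alpha>
  proof
    show "space M = UNIV" "doubling d M C\<^sub>D" "\<And>r x. 0 < r \<Longrightarrow> qball d x r \<in> sets M"
      using space unfolding hoelder_doubling_space_def by blast+
  qed (fact K1 dist hol regular)+
  obtain \<nu> c \<gamma> \<epsilon> \<eta> where const: "\<nu> < 1" "0 < c" "c < 1" "0 < \<gamma>" "\<gamma> < 1"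
    and eps: "0 < \<epsilon>" "\<epsilon> < 1" and eta: "1 < \<eta>"
    and DB_CD: "\<And>f. f \<in> fin_funs d M \<Omega> S \<Longrightarrow> double_ball d \<Omega> S \<K> f \<gamma> \<epsilon> \<eta>"
      "\<And>f. f \<in> fin_funs d M \<Omega> S \<Longrightarrow> critical_density d M \<Omega> S \<K> f \<nu> c \<epsilon> \<eta>"
    using A_or_B
  proof (elim disjE conjE exE)
    fix \<nu> c \<gamma> \<epsilon> \<eta>
    assume A: "\<nu> < 1" "0 < c" "c < 1" "0 < \<gamma>" "\<gamma> < 1" "0 < \<epsilon>" "\<epsilon> < 1" "1 < \<eta>"
      and "\<forall>f\<in>fin_funs d M \<Omega> S.
              double_ball d \<Omega> S \<K> f \<gamma> \<epsilon> \<eta> \<and> critical_density d M \<Omega> S \<K> f \<nu> c \<epsilon> \<eta>"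
    then show thesis by (intro that[OF A]) blast+
  next
    fix \<nu> c \<epsilon> \<eta>
    assume B: "\<nu> < 1 / C\<^sub>D\<^sup>2" "0 < c" "c < 1" "0 < \<epsilon>" "\<epsilon> < 1" "1 < \<eta>"
      and "\<forall>f\<in>fin_funs d M \<Omega> S. critical_density d M \<Omega> S \<K> f \<nu> c \<epsilon> \<eta>"
    then have CD: "critical_density d M \<Omega> S \<K> f \<nu> c \<epsilon> \<eta>" if "f \<in> fin_funs d M \<Omega> S" for f
      using that by blast
    have "1 / C\<^sub>D\<^sup>2 \<le> 1" using doubling_constant_ge_1 by (simp add: one_le_power)
    then have nu: "\<nu> < 1" using B by linarith
    have eta: "1 < 2 * \<eta>" using B by simp
    show thesis
    \<comment> \<open>In case (B) the constant \<open>c\<close> also serves as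
      \<open>\<gamma>\<close>, and the dilation is \<open>2 * \<eta>\<close> for both
      properties.\<close>
    proof (rule that[OF nu B(2,3) B(2,3) B(4,5) eta])
      fix f assume f: "f \<in> fin_funs d M \<Omega> S"
      show "double_ball d \<Omega> S \<K> f c \<epsilon> (2 * \<eta>)"
        by (rule double_ball_of_critical_density[OF S K f CD[OF f] B(1) B(6)])
      show "critical_density d M \<Omega> S \<K> f \<nu> c \<epsilon> (2 * \<eta>)"
        using B by (intro critical_density_enlarge[OF S f CD[OF f]]) auto
    qed
  qed
  interpret critical_density_double_ball d M C\<^sub>D K \<beta> \<alpha> \<Omega> S \<K> \<nu> c \<gamma> \<epsilon> \<eta>
    by unfold_locales (fact S K const eps eta DB_CD)+
  obtain \<gamma>\<^sub>P C \<eta>\<^sub>P where "0 < \<gamma>\<^sub>P" "\<gamma>\<^sub>P < 1" "1 < C" "1 < \<eta>\<^sub>P"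
    "\<forall>f\<in>fin_funs d M \<Omega> S. power_decay d M \<Omega> S \<K> f C \<gamma>\<^sub>P \<epsilon> \<eta>\<^sub>P"
    using power_decay_uniform by (elim exE conjE)
  with eps show ?thesis
    by (intro exI[of _ \<gamma>\<^sub>P] exI[of _ \<epsilon>] exI[of _ C] exI[of _ \<eta>\<^sub>P] conjI)
qed

end
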